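(* Let $L\subseteq\overline{\mathbb{Q}}$ be a field. If $A\subseteq L$ is existentially definable in $L$, then $A$ is definable in $L$ by a formula of the form $$\alpha(X)=\bigvee_{i=1}^r\beta_i(X),$$ where each $\beta_i(X)$ has one of the following forms: (i) the quantifier-free formula $X=z_0$ for a fixed $z_0\in L$; (ii) an absolutely irreducible hypersurface formula with coefficients from $L$ which is satisfied (in $L$) by infinitely many $x\in L$.
   Context: $\overline{\mathbb{Q}}$ is a fixed algebraic closure of $\mathbb{Q}$. A subset $A\subseteq L$ is existentially definable in $L$ if it is the set of $x\in L$ satisfying in $L$ a formula $\exists\vec Y\,\phi(X,\vec Y)$, where $\phi$ is a quantifier-free formula in the language of rings with parameters from $L$. An absolutely irreducible hypersurface formula is a formula of the form $$\exists Y_1\cdots\exists Y_e\,[\,f(X,Y_1,\dots,Y_e)=0\neq g(X,Y_1,\dots,Y_e)\,]$$ with $f,g\in\overline{\mathbb{Q}}[X,Y_1,\dots,Y_e]$, where $f$ is absolutely irreducible (irreducible over $\overline{\mathbb{Q}}$) and does not divide $g$. The empty disjunction ($r=0$, defining $\emptyset$) is allowed. The number $e$ of quantified variables may depend on $i$. *)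

theory Defs
  imports
    "HOL-Algebra.Algebraic_Closure_Type"
    "HOL-Algebra.Subrings"
    "HOL-Library.Poly_Mapping"
begin

section \<open>The ambient field and its subfields\<close>

type_synonym qbar = "rat alg_closure"

text \<open>
  A subfield of a field type is an instance of the predicate \<^const>\<open>subfield\<close> of HOL-Algebra,
  taken in \<^const>\<open>ring_of_type_algebra\<close>, the ring structure of the whole type.
\<close>

lemma subfield_ring_of_type_algebra_iff:
  fixes L :: "'a :: Fields.field set"
  shows "subfield L ring_of_type_algebra \<longleftrightarrow>
    1 \<in> L \<and> (\<forall>x\<in>L. \<forall>y\<in>L. x - y \<in> L \<and> x * y \<in> L) \<and> (\<forall>x\<in>L. inverse x \<in> L)"
proof -
  define R where "R = (ring_of_type_algebra :: 'a ring)"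
  interpret field R unfolding R_def by rule
  have R: "carrier R = UNIV" "\<one>\<^bsub>R\<^esub> = 1" "\<zero>\<^bsub>R\<^esub> = 0"
    "\<And>x y. x \<otimes>\<^bsub>R\<^esub> y = x * y" "\<And>x y. x \<oplus>\<^bsub>R\<^esub> y = x + y"
    by (auto simp: R_def ring_of_type_algebra_def)
  have R_minus: "\<ominus>\<^bsub>R\<^esub> x = - x" for x
    using minus_equality[of "- x" x] by (simp add: R)
  have R_inv: "inv\<^bsub>R\<^esub> x = inverse x" if "x \<noteq> 0" for x
    using comm_inv_char[of x "inverse x"] that by (simp add: R)
  show ?thesis unfolding R_def [symmetric]
  proof
    assume L: "subfield L R"
    note sub = subringE[OF subfieldE(1)[OF L]]
    have "x - y \<in> L" if "x \<in> L" "y \<in> L" for x y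
      using sub(7)[OF that(1) sub(5)[OF that(2)]] by (simp add: R R_minus)
    moreover have "inverse x \<in> L" if "x \<in> L" for x
      using subfield_m_inv(1)[OF L, of x] that R_inv[of x] by (cases "x = 0") (auto simp: R)
    ultimately show "1 \<in> L \<and> (\<forall>x\<in>L. \<forall>y\<in>L. x - y \<in> L \<and> x * y \<in> L) \<and> (\<forall>x\<in>L. inverse x \<in> L)"
      using sub(3,6) by (auto simp: R)
  next
    assume L: "1 \<in> L \<and> (\<forall>x\<in>L. \<forall>y\<in>L. x - y \<in> L \<and> x * y \<in> L) \<and> (\<forall>x\<in>L. inverse x \<in> L)"
    have zero: "0 \<in> L" using L by (metis diff_self)
    have uminus: "- x \<in> L" if "x \<in> L" for x
      using L zero that by (metis diff_0)
    have "x + y \<in> L" if "x \<in> L" "y \<in> L" for x y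
      using L that uminus[of y] by (metis diff_minus_eq_add)
    hence "subring L R"
      using L uminus by (intro subringI) (auto simp: R R_minus)
    thus "subfield L R"
      using L R_inv by (intro subfieldI') (auto simp: R)
  qed
qed


section \<open>Polynomials in the variables \<open>X, Y\<^sub>1, Y\<^sub>2, \<dots>\<close>\<close>

text \<open>
  A polynomial is a finitely supported map from monomials to coefficients, and a monomial is a
  finitely supported map from variable indices to exponents. Index 0 stands for \<open>X\<close>
  and index \<open>i \<ge> 1\<close> for \<open>Y\<^sub>i\<close>.
\<close>

type_synonym 'a mpoly = "(nat \<Rightarrow>\<^sub>0 nat) \<Rightarrow>\<^sub>0 'a"

text \<open>The set \<open>K[X, Y\<^sub>1, \<dots>, Y\<^sub>e]\<close>:\<close>

definition mpolys_over :: "'a :: zero set \<Rightarrow> nat \<Rightarrow> 'a mpoly set" where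
  "mpolys_over K e =
     {p. (\<forall>m\<in>Poly_Mapping.keys p. Poly_Mapping.lookup p m \<in> K) \<and>
        (\<forall>m\<in>Poly_Mapping.keys p. Poly_Mapping.keys m \<subseteq> {0..e})}"

definition eval_mpoly :: "(nat \<Rightarrow> 'a :: comm_semiring_1) \<Rightarrow> 'a mpoly \<Rightarrow> 'a" where
  "eval_mpoly v p =
     (\<Sum>m\<in>Poly_Mapping.keys p.
        Poly_Mapping.lookup p m * (\<Prod>i\<in>Poly_Mapping.keys m. v i ^ Poly_Mapping.lookup m i))"

text \<open>
  Divisibility and irreducibility below are the library notions for the type
  \<^typ>\<open>'a mpoly\<close>, which has infinitely many variables. The following lemmas show that for elements of
  \<open>K[X, Y\<^sub>1, \<dots>, Y\<^sub>e]\<close>, with \<open>K\<close> the whole coefficient field, these agree with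
  divisibility and irreducibility inside \<open>K[X, Y\<^sub>1, \<dots>, Y\<^sub>e]\<close>.
\<close>

lemma mpolys_over_factor:
  fixes p q :: "'a :: idom mpoly"
  assumes "p * q \<in> mpolys_over UNIV e" and "p \<noteq> 0" and "q \<noteq> 0"
  shows "p \<in> mpolys_over UNIV e"
proof (rule ccontr)
  assume "p \<notin> mpolys_over UNIV e"
  then obtain m0 i where m0: "m0 \<in> Poly_Mapping.keys p" "i \<in> Poly_Mapping.keys m0" "i > e"
    by (auto simp: mpolys_over_def subset_iff not_le)
  define dg where "dg = (\<lambda>r :: 'a mpoly. Max ((\<lambda>m. Poly_Mapping.lookup m i) ` Poly_Mapping.keys r))"
  define tp where "tp = (\<lambda>r :: 'a mpoly. Poly_Mapping.mapp (\<lambda>m c. if Poly_Mapping.lookup m i = dg r then c else 0) r)"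
  have look: "Poly_Mapping.lookup (tp r) m = (if Poly_Mapping.lookup m i = dg r then Poly_Mapping.lookup r m else 0)" for r m
    by (auto simp: tp_def lookup_mapp in_keys_iff when_def)
  have dg_ge: "Poly_Mapping.lookup m i \<le> dg r" if "m \<in> Poly_Mapping.keys r" for m r
    using that by (auto simp: dg_def)
  have dg_att: "\<exists>m\<in>Poly_Mapping.keys r. Poly_Mapping.lookup m i = dg r" if "r \<noteq> 0" for r
  proof -
    have "Poly_Mapping.keys r \<noteq> {}"
      using that by (metis in_keys_iff empty_iff lookup_zero poly_mapping_eqI)
    hence "dg r \<in> (\<lambda>m. Poly_Mapping.lookup m i) ` Poly_Mapping.keys r"
      unfolding dg_def by (intro Max_in) auto
    thus ?thesis by auto
  qed
  have tp_nz: "tp r \<noteq> 0" if "r \<noteq> 0" for r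
    using dg_att[OF that] look[of r] by (metis in_keys_iff lookup_zero)
  have keys_tp: "Poly_Mapping.lookup m i = dg r" if "m \<in> Poly_Mapping.keys (tp r)" for m r
    using that look[of r m] by (auto simp: in_keys_iff split: if_splits)
  have keys_low: "Poly_Mapping.lookup m i < dg r" if "m \<in> Poly_Mapping.keys (r - tp r)" for m r
  proof -
    have "Poly_Mapping.lookup m i \<noteq> dg r" "m \<in> Poly_Mapping.keys r"
      using that look[of r m] by (auto simp: in_keys_iff lookup_minus split: if_splits)
    thus ?thesis using dg_ge[of m r] by simp
  qed
  have "tp p * tp q \<noteq> 0"
    using assms tp_nz by simp
  then obtain m where m: "m \<in> Poly_Mapping.keys (tp p * tp q)"
    by (metis in_keys_iff lookup_zero poly_mapping_eqI)
  then obtain a b where "m = a + b" "a \<in> Poly_Mapping.keys (tp p)" "b \<in> Poly_Mapping.keys (tp q)"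
    using keys_mult by blast
  hence mi: "Poly_Mapping.lookup m i = dg p + dg q"
    using keys_tp by (simp add: lookup_add)
  have 1: "m \<notin> Poly_Mapping.keys ((p - tp p) * q)"
  proof
    assume "m \<in> Poly_Mapping.keys ((p - tp p) * q)"
    then obtain a b where "m = a + b" "a \<in> Poly_Mapping.keys (p - tp p)" "b \<in> Poly_Mapping.keys q"
      using keys_mult by blast
    thus False using mi keys_low[of a p] dg_ge[of b q] by (simp add: lookup_add)
  qed
  have 2: "m \<notin> Poly_Mapping.keys (tp p * (q - tp q))"
  proof
    assume "m \<in> Poly_Mapping.keys (tp p * (q - tp q))"
    then obtain a b where "m = a + b" "a \<in> Poly_Mapping.keys (tp p)" "b \<in> Poly_Mapping.keys (q - tp q)"
      using keys_mult by blast
    thus False using mi keys_low[of b q] keys_tp[of a p] by (simp add: lookup_add)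
  qed
  have "p * q = (p - tp p) * q + tp p * (q - tp q) + tp p * tp q"
    by (simp add: algebra_simps)
  hence "Poly_Mapping.lookup (p * q) m = Poly_Mapping.lookup (tp p * tp q) m"
    using 1 2 by (simp add: lookup_add in_keys_iff)
  hence "m \<in> Poly_Mapping.keys (p * q)"
    using m by (simp add: in_keys_iff)
  moreover have "dg p > 0"
    using dg_ge[OF m0(1)] m0(2) by (simp add: in_keys_iff)
  hence "i \<in> Poly_Mapping.keys m"
    using mi by (simp add: in_keys_iff)
  ultimately show False
    using assms(1) m0(3) by (force simp: mpolys_over_def)
qed

lemma dvd_mpolys_over_iff:
  fixes f g :: "'a :: idom mpoly"
  assumes "g \<in> mpolys_over UNIV e"
  shows "f dvd g \<longleftrightarrow> (\<exists>h\<in>mpolys_over UNIV e. g = f * h)"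
proof
  assume "f dvd g"
  then obtain h where h: "g = f * h" by (elim dvdE)
  show "\<exists>h\<in>mpolys_over UNIV e. g = f * h"
  proof (cases "f = 0 \<or> h = 0")
    case True
    hence "g = f * 0" using h by auto
    thus ?thesis by (intro bexI[of _ 0]) (auto simp: mpolys_over_def)
  next
    case False
    thus ?thesis using mpolys_over_factor[of h f e] assms h by (auto simp: mult.commute)
  qed
qed auto

lemma irreducible_mpolys_over_iff:
  fixes f :: "'a :: idom mpoly"
  assumes "f \<in> mpolys_over UNIV e"
  shows "Factorial_Ring.irreducible f \<longleftrightarrow>
    f \<noteq> 0 \<and> \<not> (\<exists>h\<in>mpolys_over UNIV e. f * h = 1) \<and>
    (\<forall>p\<in>mpolys_over UNIV e. \<forall>q\<in>mpolys_over UNIV e. f = p * q \<longrightarrow>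
       (\<exists>h\<in>mpolys_over UNIV e. p * h = 1) \<or> (\<exists>h\<in>mpolys_over UNIV e. q * h = 1))"
proof -
  have one: "(1 :: 'a mpoly) \<in> mpolys_over UNIV e"
    by (auto simp: mpolys_over_def)
  have unit: "r dvd 1 \<longleftrightarrow> (\<exists>h\<in>mpolys_over UNIV e. r * h = 1)" for r :: "'a mpoly"
    using dvd_mpolys_over_iff[OF one, of r] by metis
  have "p \<in> mpolys_over UNIV e \<and> q \<in> mpolys_over UNIV e" if "f = p * q" "f \<noteq> 0" for p q
    using that assms mpolys_over_factor[of p q e] mpolys_over_factor[of q p e]
    by (auto simp: mult.commute)
  thus ?thesis
    unfolding Factorial_Ring.irreducible_def unit by blast
qed


section \<open>Existentially definable sets\<close>

datatype (term_params: 'a) ring_term =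
    TVar nat | TParam 'a | TZero | TOne
  | TMinus "'a ring_term" | TAdd "'a ring_term" "'a ring_term" | TMult "'a ring_term" "'a ring_term"

datatype (qf_params: 'a) qf_formula =
    FEq "'a ring_term" "'a ring_term"
  | FNot "'a qf_formula" | FAnd "'a qf_formula" "'a qf_formula" | FOr "'a qf_formula" "'a qf_formula"

primrec term_vars :: "'a ring_term \<Rightarrow> nat set" where
  "term_vars (TVar i) = {i}"
| "term_vars (TParam c) = {}"
| "term_vars TZero = {}"
| "term_vars TOne = {}"
| "term_vars (TMinus t) = term_vars t"
| "term_vars (TAdd s t) = term_vars s \<union> term_vars t"
| "term_vars (TMult s t) = term_vars s \<union> term_vars t"

primrec qf_vars :: "'a qf_formula \<Rightarrow> nat set" where
  "qf_vars (FEq s t) = term_vars s \<union> term_vars t"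
| "qf_vars (FNot \<phi>) = qf_vars \<phi>"
| "qf_vars (FAnd \<phi> \<psi>) = qf_vars \<phi> \<union> qf_vars \<psi>"
| "qf_vars (FOr \<phi> \<psi>) = qf_vars \<phi> \<union> qf_vars \<psi>"

primrec eval_term :: "(nat \<Rightarrow> 'a :: comm_ring_1) \<Rightarrow> 'a ring_term \<Rightarrow> 'a" where
  "eval_term v (TVar i) = v i"
| "eval_term v (TParam c) = c"
| "eval_term v TZero = 0"
| "eval_term v TOne = 1"
| "eval_term v (TMinus t) = - eval_term v t"
| "eval_term v (TAdd s t) = eval_term v s + eval_term v t"
| "eval_term v (TMult s t) = eval_term v s * eval_term v t"

primrec qf_holds :: "(nat \<Rightarrow> 'a :: comm_ring_1) \<Rightarrow> 'a qf_formula \<Rightarrow> bool" where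
  "qf_holds v (FEq s t) \<longleftrightarrow> eval_term v s = eval_term v t"
| "qf_holds v (FNot \<phi>) \<longleftrightarrow> \<not> qf_holds v \<phi>"
| "qf_holds v (FAnd \<phi> \<psi>) \<longleftrightarrow> qf_holds v \<phi> \<and> qf_holds v \<psi>"
| "qf_holds v (FOr \<phi> \<psi>) \<longleftrightarrow> qf_holds v \<phi> \<or> qf_holds v \<psi>"

text \<open>
  The assignments of values \<open>x, y\<^sub>1, \<dots>, y\<^sub>e\<close> to \<open>X, Y\<^sub>1, \<dots>, Y\<^sub>e\<close> with all \<open>y\<^sub>i\<close> in \<open>L\<close>; the values
  at indices above \<open>e\<close> are unconstrained and never used. Quantification over these assignments
  is existential quantification over \<open>L\<close>; atomic formulas may be evaluated in the ambient
  ring because \<open>L\<close> is a subring.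
\<close>

definition assignments :: "'a set \<Rightarrow> nat \<Rightarrow> 'a \<Rightarrow> (nat \<Rightarrow> 'a) set" where
  "assignments L e x = {v. v 0 = x \<and> (\<forall>i\<in>{1..e}. v i \<in> L)}"

definition existentially_definable :: "'a :: comm_ring_1 set \<Rightarrow> 'a set \<Rightarrow> bool" where
  "existentially_definable L A \<longleftrightarrow>
     (\<exists>e \<phi>. qf_params \<phi> \<subseteq> L \<and> qf_vars \<phi> \<subseteq> {0..e} \<and>
            A = {x \<in> L. \<exists>v\<in>assignments L e x. qf_holds v \<phi>})"


section \<open>Disjunctions of point formulas and hypersurface formulas\<close>

text \<open>
  \<open>Point z\<close> is the formula \<open>X = z\<close>, and \<open>Hypersurface e f g\<close> is the formula
  \<open>\<exists>Y\<^sub>1 \<dots> Y\<^sub>e. f(X, Y\<^sub>1, \<dots>, Y\<^sub>e) = 0 \<noteq> g(X, Y\<^sub>1, \<dots>, Y\<^sub>e)\<close>. A list of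
  these is read as their disjunction.
\<close>

datatype disjunct = Point qbar | Hypersurface nat "qbar mpoly" "qbar mpoly"

primrec disjunct_holds :: "qbar set \<Rightarrow> disjunct \<Rightarrow> qbar \<Rightarrow> bool" where
  "disjunct_holds L (Point z) x \<longleftrightarrow> x = z"
| "disjunct_holds L (Hypersurface e f g) x \<longleftrightarrow>
     (\<exists>v\<in>assignments L e x. eval_mpoly v f = 0 \<and> eval_mpoly v g \<noteq> 0)"

definition defined_set :: "qbar set \<Rightarrow> disjunct list \<Rightarrow> qbar set" where
  "defined_set L \<alpha> = {x \<in> L. \<exists>\<beta>\<in>set \<alpha>. disjunct_holds L \<beta> x}"

definition abs_irreducible_hypersurface :: "nat \<Rightarrow> qbar mpoly \<Rightarrow> qbar mpoly \<Rightarrow> bool" where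
  "abs_irreducible_hypersurface e f g \<longleftrightarrow>
     f \<in> mpolys_over UNIV e \<and> g \<in> mpolys_over UNIV e \<and>
     Factorial_Ring.irreducible f \<and> \<not> f dvd g"

text \<open>
  The irreducibility condition is over the whole algebraic closure, although the coefficients
  lie in \<open>L\<close>.
\<close>

primrec admissible :: "qbar set \<Rightarrow> disjunct \<Rightarrow> bool" where
  "admissible L (Point z) \<longleftrightarrow> z \<in> L"
| "admissible L (Hypersurface e f g) \<longleftrightarrow>
     abs_irreducible_hypersurface e f g \<and>
     f \<in> mpolys_over L e \<and> g \<in> mpolys_over L e \<and>
     infinite {x \<in> L. disjunct_holds L (Hypersurface e f g) x}"

end

theory Submission
  imports Defs
begin

text \<open>
  Suppose that \<open>A\<close> is not a finite union of sets of the two kinds. Then there is an ultrafilter on the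
  solutions \<open>(x, y)\<close> in \<open>L\<close> of the quantifier-free formula that avoids all admissible subsets of \<open>A\<close>; it
  behaves like a generic point over \<open>L\<close>. Single points being admissible, its coordinate \<open>x\<close> is
  transcendental, so it extends to a transcendence base \<open>T\<close> among the coordinates. The remaining
  coordinates are rational functions of \<open>T\<close> and one primitive element \<open>z\<close>. A polynomial
  \<open>f(T, z)\<close> over \<open>L\<close> in the vanishing ideal of least degree in \<open>z\<close> and then of least total degree is
  absolutely irreducible, because the vanishing ideal is prime over the whole field and has a basis over
  \<open>L\<close>. Outside the zeros of a suitable \<open>g\<close>, points of \<open>f = 0\<close> are mapped to solutions of
  the formula, so \<open>f = 0 \<noteq> g\<close> defines an admissible subset of \<open>A\<close> that is not avoided.
\<close>

section \<open>Polynomials over subrings\<close>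

text \<open>Absolute irreducibility is the delicate point: a variety irreducible over
  \<open>L\<close> may split over the algebraic closure. Its conjugate components then share all
  points with coordinates in \<open>L\<close>, so such points fill only a smaller closed set. As
  \<open>U\<close> lives on points over \<open>L\<close>, its generic point sees no splitting. In
  the proof this is linear algebra: values in \<open>L\<close> combined with
  \<open>L\<close>-independent coefficients give zero only if all of them are zero. The degree is
  minimized in two stages because least degree in \<open>z\<close> fixes \<open>f\<close> only up to
  a factor from \<open>L(T)\<close>; least total degree removes the factors involving
  \<open>T\<close> alone. No function field is constructed. Its elements are functions of
  assignments taken modulo \<open>U\<close>, and denominators are cleared, so all arguments run over
  \<open>L[T]\<close>. The ultrafilter acts as compactness: disjunctions can be concatenated, so the
  conditions of avoiding a definable subset form a filter base, and no induction on dimension is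
  made. Infinitude of the solution set follows in the same spirit, since finitely many first
  coordinates would make \<open>x\<close> constant along \<open>U\<close>.\<close>

definition subring_set :: "'a :: comm_ring_1 set \<Rightarrow> bool" where
  "subring_set R \<longleftrightarrow> 1 \<in> R \<and> (\<forall>x\<in>R. \<forall>y\<in>R. x - y \<in> R \<and> x * y \<in> R)"

context
  fixes R :: "'a :: comm_ring_1 set"
  assumes R: "subring_set R"
begin

lemma subring_set_one: "1 \<in> R"
  and subring_set_diff: "x \<in> R \<Longrightarrow> y \<in> R \<Longrightarrow> x - y \<in> R"
  and subring_set_mult: "x \<in> R \<Longrightarrow> y \<in> R \<Longrightarrow> x * y \<in> R"
  using R by (auto simp: subring_set_def)

lemma subring_set_zero: "0 \<in> R"
  using subring_set_diff[OF subring_set_one subring_set_one] by simp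

lemma subring_set_uminus: "x \<in> R \<Longrightarrow> - x \<in> R"
  using subring_set_diff[OF subring_set_zero] by simp

lemma subring_set_add: "x \<in> R \<Longrightarrow> y \<in> R \<Longrightarrow> x + y \<in> R"
  using subring_set_diff[OF _ subring_set_uminus] by fastforce

lemma subring_set_sum: "(\<And>i. i \<in> I \<Longrightarrow> h i \<in> R) \<Longrightarrow> sum h I \<in> R"
  by (induction I rule: infinite_finite_induct) (auto intro: subring_set_zero subring_set_add)

lemma subring_set_prod: "(\<And>i. i \<in> I \<Longrightarrow> h i \<in> R) \<Longrightarrow> prod h I \<in> R"
  by (induction I rule: infinite_finite_induct) (auto intro: subring_set_one subring_set_mult)

lemma subring_set_power: "x \<in> R \<Longrightarrow> x ^ n \<in> R"
  by (induction n) (auto intro: subring_set_one subring_set_mult)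

lemma subring_set_of_nat: "of_nat n \<in> R"
  by (induction n) (auto intro: subring_set_zero subring_set_one subring_set_add)

end

lemmas subring_set_intros = subring_set_zero subring_set_one subring_set_uminus subring_set_add
  subring_set_diff subring_set_mult subring_set_sum subring_set_prod subring_set_power
  subring_set_of_nat

definition polys_over :: "'a :: comm_ring_1 set \<Rightarrow> 'a poly set" where
  "polys_over R = {p. \<forall>k. coeff p k \<in> R}"

lemma polys_over_pCons_iff: "pCons a p \<in> polys_over R \<longleftrightarrow> a \<in> R \<and> p \<in> polys_over R"
  by (auto simp: polys_over_def coeff_pCons split: nat.splits)

lemma polys_over_monom:
  assumes "subring_set R" "a \<in> R"
  shows "monom a n \<in> polys_over R"
  using assms by (auto simp: polys_over_def subring_set_zero)

lemma polys_over_const: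
  assumes "subring_set R" "a \<in> R"
  shows "[:a:] \<in> polys_over R"
  using polys_over_monom[OF assms, of 0] by (simp add: monom_0)

lemma subring_set_polys_over:
  assumes "subring_set R"
  shows "subring_set (polys_over R)"
  unfolding subring_set_def polys_over_def
  by (auto simp: coeff_mult one_pCons coeff_pCons assms split: nat.splits intro!: subring_set_intros)

lemma poly_in_subring_set:
  assumes "subring_set R" "p \<in> polys_over R" "x \<in> R"
  shows "poly p x \<in> R"
  unfolding poly_altdef using assms by (auto simp: polys_over_def intro!: subring_set_intros)

lemma pderiv_in_polys_over:
  fixes R :: "'a :: idom set"
  assumes "subring_set R" "p \<in> polys_over R"
  shows "pderiv p \<in> polys_over R"
  using assms by (auto simp: polys_over_def coeff_pderiv simp del: of_nat_Suc intro!: subring_set_intros)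

lemma map_poly_in_polys_over:
  assumes "p \<in> polys_over R" "\<And>a. a \<in> R \<Longrightarrow> h a \<in> S" "h 0 = 0"
  shows "map_poly h p \<in> polys_over S"
  using assms by (auto simp: polys_over_def coeff_map_poly)

section \<open>Ring homomorphisms as plain functions\<close>

definition ring_hom_fun :: "('a :: comm_ring_1 \<Rightarrow> 'b :: comm_ring_1) \<Rightarrow> bool" where
  "ring_hom_fun h \<longleftrightarrow> h 1 = 1 \<and> (\<forall>x y. h (x + y) = h x + h y) \<and> (\<forall>x y. h (x * y) = h x * h y)"

context
  fixes h :: "'a :: comm_ring_1 \<Rightarrow> 'b :: comm_ring_1"
  assumes h: "ring_hom_fun h"
begin

lemma ring_hom_fun_one: "h 1 = 1"
  and ring_hom_fun_add: "h (x + y) = h x + h y"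
  and ring_hom_fun_mult: "h (x * y) = h x * h y"
  using h by (auto simp: ring_hom_fun_def)

lemma ring_hom_fun_zero: "h 0 = 0"
  using ring_hom_fun_add[of 0 0] by simp

lemma ring_hom_fun_uminus: "h (- x) = - h x"
  using ring_hom_fun_add[of x "- x"] by (simp add: ring_hom_fun_zero add_eq_0_iff)

lemma ring_hom_fun_diff: "h (x - y) = h x - h y"
  using ring_hom_fun_add[of x "- y"] by (simp add: ring_hom_fun_uminus)

lemma ring_hom_fun_sum: "h (sum g I) = (\<Sum>i\<in>I. h (g i))"
  by (induction I rule: infinite_finite_induct) (auto simp: ring_hom_fun_zero ring_hom_fun_add)

lemma ring_hom_fun_power: "h (x ^ n) = h x ^ n"
  by (induction n) (auto simp: ring_hom_fun_one ring_hom_fun_mult)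

lemma ring_hom_fun_of_nat: "h (of_nat n) = of_nat n"
  by (induction n) (auto simp: ring_hom_fun_zero ring_hom_fun_one ring_hom_fun_add)

lemma ring_hom_fun_poly: "h (poly p x) = poly (map_poly h p) (h x)"
  by (induction p) (auto simp: ring_hom_fun_zero ring_hom_fun_add ring_hom_fun_mult map_poly_pCons)

lemma ring_hom_fun_map_poly: "ring_hom_fun (map_poly h)"
proof -
  have "map_poly h (p + q) = map_poly h p + map_poly h q" for p q
    by (rule poly_eqI) (simp add: coeff_map_poly ring_hom_fun_zero ring_hom_fun_add)
  moreover have "map_poly h (p * q) = map_poly h p * map_poly h q" for p q
    by (rule poly_eqI)
      (simp add: coeff_map_poly coeff_mult ring_hom_fun_zero ring_hom_fun_sum ring_hom_fun_mult)
  ultimately show ?thesis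
    by (simp add: ring_hom_fun_def ring_hom_fun_one map_poly_1')
qed

end

lemmas ring_hom_fun_simps = ring_hom_fun_zero ring_hom_fun_one ring_hom_fun_add ring_hom_fun_mult
  ring_hom_fun_uminus ring_hom_fun_diff ring_hom_fun_sum ring_hom_fun_power ring_hom_fun_of_nat

lemma poly_mapping_sum_single:
  "p = (\<Sum>m\<in>Poly_Mapping.keys p. Poly_Mapping.single m (Poly_Mapping.lookup p m))"
  by (rule poly_mapping_eqI)
    (auto simp: lookup_sum lookup_single when_def in_keys_iff sum.delta')

lemma poly_mapping_additive_induct [case_names single add]:
  fixes p :: "'a \<Rightarrow>\<^sub>0 'b :: comm_monoid_add"
  assumes "\<And>m c. P (Poly_Mapping.single m c)" "\<And>p q. P p \<Longrightarrow> P q \<Longrightarrow> P (p + q)"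
  shows "P p"
proof -
  have zero: "P 0"
    using assms(1)[of undefined 0] by simp
  have "P (\<Sum>m\<in>M. Poly_Mapping.single m (Poly_Mapping.lookup p m))" if "finite M" for M
    using that by induction (auto intro: assms zero)
  thus ?thesis
    using poly_mapping_sum_single[of p] by (metis finite_keys)
qed

text \<open>Distributivity reduces multiplicativity to monomials; this serves both evaluation and
  homogenization.\<close>

lemma ring_hom_fun_poly_mapping:
  fixes h :: "('a :: comm_monoid_add \<Rightarrow>\<^sub>0 'b :: comm_ring_1) \<Rightarrow> 'c :: comm_ring_1"
  assumes one: "h 1 = 1" and add: "\<And>p q. h (p + q) = h p + h q"
    and single: "\<And>m n a b. h (Poly_Mapping.single m a * Poly_Mapping.single n b)
      = h (Poly_Mapping.single m a) * h (Poly_Mapping.single n b)"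
  shows "ring_hom_fun h"
proof -
  have "h (Poly_Mapping.single m a * q) = h (Poly_Mapping.single m a) * h q" for m a q
    by (induction q rule: poly_mapping_additive_induct) (auto simp: single add distrib_left)
  hence "h (p * q) = h p * h q" for p q
    by (induction p rule: poly_mapping_additive_induct) (auto simp: add distrib_right)
  thus ?thesis
    by (auto simp: ring_hom_fun_def one add)
qed

lemma sum_keys_add:
  fixes h :: "'a \<Rightarrow> 'b :: comm_monoid_add \<Rightarrow> 'c :: comm_monoid_add"
  assumes "\<And>m. h m 0 = 0" "\<And>m a b. h m (a + b) = h m a + h m b"
  shows "(\<Sum>m\<in>Poly_Mapping.keys (p + q). h m (Poly_Mapping.lookup (p + q) m))
    = (\<Sum>m\<in>Poly_Mapping.keys p. h m (Poly_Mapping.lookup p m))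
    + (\<Sum>m\<in>Poly_Mapping.keys q. h m (Poly_Mapping.lookup q m))"
proof -
  let ?K = "Poly_Mapping.keys p \<union> Poly_Mapping.keys q"
  have K: "(\<Sum>m\<in>Poly_Mapping.keys r. h m (Poly_Mapping.lookup r m)) = (\<Sum>m\<in>?K. h m (Poly_Mapping.lookup r m))"
    if "Poly_Mapping.keys r \<subseteq> ?K" for r :: "'a \<Rightarrow>\<^sub>0 'b"
    using that by (intro sum.mono_neutral_left) (auto simp: in_keys_iff assms(1))
  show ?thesis
    unfolding K[OF keys_add] K[of p, OF Un_upper1] K[of q, OF Un_upper2]
    by (simp add: lookup_add assms(2) sum.distrib)
qed

lemma ring_hom_eval_mpoly: "ring_hom_fun (eval_mpoly v :: 'a :: comm_ring_1 mpoly \<Rightarrow> 'a)"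
proof (rule ring_hom_fun_poly_mapping)
  show "eval_mpoly v (1 :: 'a mpoly) = 1"
    by (cases "(1 :: 'a) = 0") (auto simp: eval_mpoly_def)
  show "eval_mpoly v (p + q) = eval_mpoly v p + eval_mpoly v q" for p q :: "'a mpoly"
    unfolding eval_mpoly_def by (rule sum_keys_add) (auto simp: distrib_right)
  define mv where "mv = (\<lambda>m :: nat \<Rightarrow>\<^sub>0 nat. \<Prod>i\<in>Poly_Mapping.keys m. v i ^ Poly_Mapping.lookup m i)"
  have mv_alt: "mv m = (\<Prod>i\<in>K. v i ^ Poly_Mapping.lookup m i)"
    if "finite K" "Poly_Mapping.keys m \<subseteq> K" for m K
    unfolding mv_def using that by (intro prod.mono_neutral_left) (auto simp: in_keys_iff)
  have "mv (m + n) = mv m * mv n" for m n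
    using mv_alt[of "Poly_Mapping.keys m \<union> Poly_Mapping.keys n" m]
      mv_alt[of "Poly_Mapping.keys m \<union> Poly_Mapping.keys n" n]
      mv_alt[OF _ keys_add[of m n]]
    by (simp add: lookup_add power_add prod.distrib)
  moreover have "eval_mpoly v (Poly_Mapping.single m a) = a * mv m" for m a
    by (cases "a = 0") (auto simp: eval_mpoly_def mv_def)
  ultimately show "eval_mpoly v (Poly_Mapping.single m a * Poly_Mapping.single n b)
      = eval_mpoly v (Poly_Mapping.single m a) * eval_mpoly v (Poly_Mapping.single n b)" for m n a b
    by (simp add: mult_single mult_ac)
qed

lemmas eval_mpoly_simps [simp] = ring_hom_fun_simps[OF ring_hom_eval_mpoly]
lemmas eval_mpoly_poly = ring_hom_fun_poly[OF ring_hom_eval_mpoly]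

section \<open>Multivariate polynomials with prescribed coefficients and variables\<close>

abbreviation mconst :: "'a :: zero \<Rightarrow> 'a mpoly" where
  "mconst c \<equiv> Poly_Mapping.single 0 c"

abbreviation mvar :: "nat \<Rightarrow> 'a :: zero_neq_one mpoly" where
  "mvar i \<equiv> Poly_Mapping.single (Poly_Mapping.single i (Suc 0)) 1"

lemma eval_mconst [simp]: "eval_mpoly v (mconst c) = c"
  by (cases "c = 0") (auto simp: eval_mpoly_def)

lemma eval_mvar [simp]: "eval_mpoly v (mvar i :: 'a :: comm_ring_1 mpoly) = v i"
  by (simp add: eval_mpoly_def)

lemma mvar_neq_0 [simp]: "mvar i \<noteq> 0"
  by (metis lookup_single_eq lookup_zero zero_neq_one)

lemma eval_mpoly_cong:
  assumes "\<And>m i. m \<in> Poly_Mapping.keys p \<Longrightarrow> i \<in> Poly_Mapping.keys m \<Longrightarrow> v i = w i"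
  shows "eval_mpoly v p = eval_mpoly w p"
  unfolding eval_mpoly_def using assms by (auto intro!: sum.cong prod.cong)

text \<open>\<open>V\<close> is arbitrary because the relevant rings are \<open>L[T]\<close> and
  \<open>L[T, z]\<close>, where the transcendence base \<open>T\<close> need not be an initial
  segment of the coordinates.\<close>

definition mpolys_in :: "'a :: zero set \<Rightarrow> nat set \<Rightarrow> 'a mpoly set" where
  "mpolys_in K V = {p. (\<forall>m. Poly_Mapping.lookup p m \<in> K) \<and>
     (\<forall>m\<in>Poly_Mapping.keys p. Poly_Mapping.keys m \<subseteq> V)}"

lemma mpolys_in_mono: "K \<subseteq> K' \<Longrightarrow> V \<subseteq> V' \<Longrightarrow> mpolys_in K V \<subseteq> mpolys_in K' V'"
  unfolding mpolys_in_def by blast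

lemma mpolys_in_imp_over: "p \<in> mpolys_in K V \<Longrightarrow> V \<subseteq> {0..e} \<Longrightarrow> p \<in> mpolys_over K e"
  unfolding mpolys_in_def mpolys_over_def by blast

lemma eval_mpoly_cong_in:
  assumes "p \<in> mpolys_in K V" "\<And>i. i \<in> V \<Longrightarrow> v i = w i"
  shows "eval_mpoly v p = eval_mpoly w p"
  using assms by (intro eval_mpoly_cong) (auto simp: mpolys_in_def)

lemma single_in_mpolys_in:
  assumes "0 \<in> K" "c \<in> K" "Poly_Mapping.keys m \<subseteq> V"
  shows "Poly_Mapping.single m c \<in> mpolys_in K V"
  using assms by (auto simp: mpolys_in_def lookup_single when_def)

lemma add_in_mpolys_in:
  assumes "subring_set K" "p \<in> mpolys_in K V" "q \<in> mpolys_in K V"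
  shows "p + q \<in> mpolys_in K V"
  using assms keys_add[of p q] unfolding mpolys_in_def
  by (auto simp: lookup_add intro!: subring_set_intros) blast

lemma subring_set_mpolys_in:
  fixes K :: "'a :: comm_ring_1 set"
  assumes K: "subring_set K"
  shows "subring_set (mpolys_in K V)"
proof -
  have "1 \<in> mpolys_in K V"
    unfolding single_one[symmetric] by (rule single_in_mpolys_in) (auto intro: subring_set_intros K)
  moreover have "p - q \<in> mpolys_in K V" if "p \<in> mpolys_in K V" "q \<in> mpolys_in K V" for p q
  proof -
    have "Poly_Mapping.keys (p - q) \<subseteq> Poly_Mapping.keys p \<union> Poly_Mapping.keys q"
      by (auto simp: in_keys_iff lookup_minus)
    thus ?thesis using that K unfolding mpolys_in_def
      by (auto simp: lookup_minus intro!: subring_set_intros) blast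
  qed
  moreover have "p * q \<in> mpolys_in K V" if "p \<in> mpolys_in K V" "q \<in> mpolys_in K V" for p q
  proof -
    have "p * q = (\<Sum>m\<in>Poly_Mapping.keys p. \<Sum>n\<in>Poly_Mapping.keys q.
        Poly_Mapping.single (m + n) (Poly_Mapping.lookup p m * Poly_Mapping.lookup q n))"
      by (subst poly_mapping_sum_single[of p], subst poly_mapping_sum_single[of q])
        (simp add: sum_product mult_single)
    moreover have "Poly_Mapping.single (m + n) (Poly_Mapping.lookup p m * Poly_Mapping.lookup q n)
        \<in> mpolys_in K V" if "m \<in> Poly_Mapping.keys p" "n \<in> Poly_Mapping.keys q" for m n
    proof (rule single_in_mpolys_in)
      show "Poly_Mapping.lookup p m * Poly_Mapping.lookup q n \<in> K"
        using \<open>p \<in> _\<close> \<open>q \<in> _\<close> K by (auto simp: mpolys_in_def intro: subring_set_mult)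
      show "Poly_Mapping.keys (m + n) \<subseteq> V"
        using that \<open>p \<in> _\<close> \<open>q \<in> _\<close> keys_add[of m n] unfolding mpolys_in_def by blast
    qed (rule subring_set_zero[OF K])
    moreover have sum_in: "sum g I \<in> mpolys_in K V" if "\<And>i. i \<in> I \<Longrightarrow> g i \<in> mpolys_in K V"
      for I :: "(nat \<Rightarrow>\<^sub>0 nat) set" and g
    proof -
      have "0 \<in> mpolys_in K V"
        by (auto simp: mpolys_in_def subring_set_zero[OF K])
      thus ?thesis
        using that by (induction I rule: infinite_finite_induct) (auto intro: add_in_mpolys_in[OF K])
    qed
    ultimately show ?thesis by (metis (no_types, lifting) sum_in)
  qed
  ultimately show ?thesis by (auto simp: subring_set_def)
qed

lemma mconst_in_mpolys_in: "subring_set K \<Longrightarrow> c \<in> K \<Longrightarrow> mconst c \<in> mpolys_in K V"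
  by (rule single_in_mpolys_in) (auto intro: subring_set_intros)

lemma mvar_in_mpolys_in: "subring_set K \<Longrightarrow> i \<in> V \<Longrightarrow> mvar i \<in> mpolys_in K V"
  by (rule single_in_mpolys_in) (auto intro: subring_set_intros)

lemma eval_mpoly_in:
  assumes K: "subring_set K" and "p \<in> mpolys_in K V" "\<And>i. i \<in> V \<Longrightarrow> v i \<in> K"
  shows "eval_mpoly v p \<in> K"
proof -
  have "v i \<in> K" if "m \<in> Poly_Mapping.keys p" "i \<in> Poly_Mapping.keys m" for m i
    using that assms by (auto simp: mpolys_in_def)
  moreover have "Poly_Mapping.lookup p m \<in> K" for m
    using assms by (auto simp: mpolys_in_def)
  ultimately show ?thesis
    unfolding eval_mpoly_def by (auto intro!: subring_set_intros K)
qed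

text \<open>The degree for a weighting of the monomials is the degree of the univariate polynomial obtained
  by multiplying every monomial of weight \<open>k\<close> by \<open>Z ^ k\<close>; this makes it additive on products.\<close>

definition homogenize :: "((nat \<Rightarrow>\<^sub>0 nat) \<Rightarrow> nat) \<Rightarrow> 'a :: comm_ring_1 mpoly \<Rightarrow> 'a mpoly poly" where
  "homogenize w p = (\<Sum>m\<in>Poly_Mapping.keys p.
     monom (Poly_Mapping.single m (Poly_Mapping.lookup p m)) (w m))"

definition wdegree :: "((nat \<Rightarrow>\<^sub>0 nat) \<Rightarrow> nat) \<Rightarrow> 'a :: comm_ring_1 mpoly \<Rightarrow> nat" where
  "wdegree w p = degree (homogenize w p)"

definition weight :: "((nat \<Rightarrow>\<^sub>0 nat) \<Rightarrow> nat) \<Rightarrow> bool" where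
  "weight w \<longleftrightarrow> w 0 = 0 \<and> (\<forall>m n. w (m + n) = w m + w n)"

lemma ring_hom_homogenize:
  assumes "weight w"
  shows "ring_hom_fun (homogenize w :: 'a :: comm_ring_1 mpoly \<Rightarrow> _)"
proof (rule ring_hom_fun_poly_mapping)
  have single: "homogenize w (Poly_Mapping.single m a) = monom (Poly_Mapping.single m a) (w m)"
    for m and a :: 'a
    by (cases "a = 0") (auto simp: homogenize_def)
  show "homogenize w (1 :: 'a mpoly) = 1"
    using single[of 0 1] assms by (simp add: weight_def)
  show "homogenize w (p + q) = homogenize w p + homogenize w q" for p q :: "'a mpoly"
    unfolding homogenize_def by (rule sum_keys_add) (auto simp: single_add add_monom)
  show "homogenize w (Poly_Mapping.single m a * Poly_Mapping.single n b)
      = homogenize w (Poly_Mapping.single m a) * homogenize w (Poly_Mapping.single n b)"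
    for m n and a b :: 'a
    using assms by (simp add: single mult_single mult_monom weight_def)
qed

lemma homogenize_eq_0_iff [simp]: "homogenize w p = 0 \<longleftrightarrow> p = 0"
proof
  have "poly (homogenize w p) 1 = p"
    unfolding homogenize_def
    by (subst (3) poly_mapping_sum_single[of p]) (simp add: poly_sum poly_monom)
  thus "p = 0" if "homogenize w p = 0"
    using that by auto
qed (auto simp: homogenize_def)

lemma wdegree_mult:
  fixes p q :: "'a :: idom mpoly"
  assumes "weight w" "p \<noteq> 0" "q \<noteq> 0"
  shows "wdegree w (p * q) = wdegree w p + wdegree w q"
  using assms by (simp add: wdegree_def ring_hom_fun_mult[OF ring_hom_homogenize] degree_mult_eq)

lemma wdegree_le_iff: "wdegree w p \<le> N \<longleftrightarrow> (\<forall>m\<in>Poly_Mapping.keys p. w m \<le> N)"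
proof
  assume "\<forall>m\<in>Poly_Mapping.keys p. w m \<le> N"
  thus "wdegree w p \<le> N"
    unfolding wdegree_def homogenize_def
    by (intro degree_sum_le) (auto intro: order.trans[OF degree_monom_le])
next
  assume N: "wdegree w p \<le> N"
  have "w m \<le> wdegree w p" if "m \<in> Poly_Mapping.keys p" for m
  proof -
    have "Poly_Mapping.lookup (coeff (homogenize w p) (w m)) m
        = (\<Sum>n\<in>Poly_Mapping.keys p. if n = m then Poly_Mapping.lookup p m else 0)"
      unfolding homogenize_def coeff_sum lookup_sum by (rule sum.cong) (auto simp: lookup_single when_def)
    also have "\<dots> \<noteq> 0"
      using that by (simp add: in_keys_iff)
    finally show ?thesis
      unfolding wdegree_def by (intro le_degree) auto
  qed
  thus "\<forall>m\<in>Poly_Mapping.keys p. w m \<le> N"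
    using N by fastforce
qed

lemma wdegree_mono: "Poly_Mapping.keys p \<subseteq> Poly_Mapping.keys q \<Longrightarrow> wdegree w p \<le> wdegree w q"
  using wdegree_le_iff[of w q "wdegree w q"] by (auto simp: wdegree_le_iff)

lemma weight_sum_lookup [simp]: "weight (\<lambda>m. \<Sum>i\<in>I. Poly_Mapping.lookup m i)"
  by (simp add: weight_def lookup_add sum.distrib)

text \<open>Both degrees minimized later are instances: the single variable for \<open>z\<close>
  gives the degree in \<open>z\<close>, all variables in use give the total degree.\<close>

definition degree_in :: "nat set \<Rightarrow> 'a :: comm_ring_1 mpoly \<Rightarrow> nat" where
  "degree_in I = wdegree (\<lambda>m. \<Sum>i\<in>I. Poly_Mapping.lookup m i)"

lemma wdegree_add_eq:
  assumes "weight w" "wdegree w p < wdegree w q"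
  shows "wdegree w (p + q) = wdegree w q"
  using assms by (simp add: wdegree_def ring_hom_fun_add[OF ring_hom_homogenize] degree_add_eq_right)

lemma degree_in_mult:
  fixes p q :: "'a :: idom mpoly"
  shows "p \<noteq> 0 \<Longrightarrow> q \<noteq> 0 \<Longrightarrow> degree_in I (p * q) = degree_in I p + degree_in I q"
  by (simp add: degree_in_def wdegree_mult)

lemma degree_in_mono: "Poly_Mapping.keys p \<subseteq> Poly_Mapping.keys q \<Longrightarrow> degree_in I p \<le> degree_in I q"
  by (simp add: degree_in_def wdegree_mono)

lemma degree_in_add_eq: "degree_in I p < degree_in I q \<Longrightarrow> degree_in I (p + q) = degree_in I q"
  by (simp add: degree_in_def wdegree_add_eq)

lemma degree_in_0 [simp]: "degree_in I 0 = 0"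
  by (simp add: degree_in_def wdegree_def homogenize_def)

lemma degree_in_eq_0_iff:
  assumes "finite I"
  shows "degree_in I p = 0 \<longleftrightarrow> (\<forall>m\<in>Poly_Mapping.keys p. Poly_Mapping.keys m \<inter> I = {})"
proof -
  have "degree_in I p = 0 \<longleftrightarrow> degree_in I p \<le> 0" by simp
  also have "\<dots> \<longleftrightarrow> (\<forall>m\<in>Poly_Mapping.keys p. Poly_Mapping.keys m \<inter> I = {})"
    unfolding degree_in_def wdegree_le_iff using assms by (auto simp: in_keys_iff disjoint_iff)
  finally show ?thesis .
qed

text \<open>The degree in a variable outside \<open>V\<close> is additive on products, so it is zero
  for both factors.\<close>

lemma mpolys_in_UNIV_factor:
  fixes p q :: "'a :: idom mpoly"
  assumes "p * q \<in> mpolys_in UNIV V" "p \<noteq> 0" "q \<noteq> 0"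
  shows "p \<in> mpolys_in UNIV V"
proof -
  have "i \<notin> Poly_Mapping.keys m" if "i \<notin> V" "m \<in> Poly_Mapping.keys p" for i m
  proof -
    have "degree_in {i} (p * q) = 0"
      using assms(1) that(1) by (subst degree_in_eq_0_iff) (auto simp: mpolys_in_def)
    hence "degree_in {i} p = 0"
      using degree_in_mult[OF assms(2,3), of "{i}"] by linarith
    thus ?thesis using that by (auto simp: degree_in_eq_0_iff)
  qed
  thus ?thesis by (auto simp: mpolys_in_def)
qed

text \<open>As the coefficients do not involve variable \<open>i\<close>, distinct powers of
  \<open>mvar i\<close> cannot cancel.\<close>

lemma degree_in_poly_mvar:
  fixes p :: "'a :: idom mpoly poly"
  assumes "i \<notin> V" "p \<in> polys_over (mpolys_in K V)"
  shows "degree_in {i} (poly p (mvar i)) = degree p" and "poly p (mvar i) = 0 \<longleftrightarrow> p = 0"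
proof -
  have "degree_in {i} (poly p (mvar i)) = degree p \<and> (poly p (mvar i) = 0 \<longleftrightarrow> p = 0)"
    using assms(2)
  proof (induction p)
    case 0
    show ?case by simp
  next
    case (pCons a p)
    let ?P = "poly p (mvar i)"
    have a: "degree_in {i} a = 0"
      using pCons.prems assms(1)
      by (subst degree_in_eq_0_iff) (auto simp: polys_over_pCons_iff mpolys_in_def)
    show ?case
    proof (cases "p = 0")
      case True
      thus ?thesis using a by simp
    next
      case False
      hence P: "?P \<noteq> 0" "degree_in {i} ?P = degree p"
        using pCons by (auto simp: polys_over_pCons_iff)
      have "degree_in {i} (mvar i :: 'a mpoly) = 1"
        by (simp add: degree_in_def wdegree_def homogenize_def degree_monom_eq)
      hence deg: "degree_in {i} (mvar i * ?P) = degree p + 1"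
        using P by (subst degree_in_mult) auto
      hence "degree_in {i} (a + mvar i * ?P) = degree p + 1"
        using a by (subst degree_in_add_eq) auto
      moreover from this have "a + mvar i * ?P \<noteq> 0"
        by auto
      ultimately show ?thesis using False by simp
    qed
  qed
  thus "degree_in {i} (poly p (mvar i)) = degree p" "poly p (mvar i) = 0 \<longleftrightarrow> p = 0"
    by auto
qed

lemma mvar_power: "mvar i ^ k = (Poly_Mapping.single (Poly_Mapping.single i k) 1 :: 'a :: comm_ring_1 mpoly)"
  by (induction k) (auto simp: mult_single single_add[symmetric])

text \<open>Lets a polynomial be read as univariate in one chosen variable, the form needed for
  pseudodivision and for counting roots.\<close>

lemma mpolys_in_insert_eq:
  fixes K :: "'a :: comm_ring_1 set"
  assumes K: "subring_set K" and p: "p \<in> mpolys_in K (insert i V)"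
  obtains p' where "p' \<in> polys_over (mpolys_in K (V - {i}))" "poly p' (mvar i) = p"
proof -
  note sub = subring_set_mpolys_in[OF K, of "V - {i}"]
  have "\<exists>q \<in> polys_over (mpolys_in K (V - {i})). poly q (mvar i) = Poly_Mapping.single m (Poly_Mapping.lookup p m)"
    if m: "m \<in> Poly_Mapping.keys p" for m
  proof -
    define k where "k = Poly_Mapping.lookup m i"
    define m' where "m' = Poly_Mapping.update i 0 m"
    have mm': "m = m' + Poly_Mapping.single i k"
      by (rule poly_mapping_eqI) (auto simp: m'_def k_def lookup_add lookup_single lookup_update when_def)
    have "Poly_Mapping.keys m' \<subseteq> V - {i}"
      using m p by (auto simp: m'_def keys_update mpolys_in_def)
    hence "Poly_Mapping.single m' (Poly_Mapping.lookup p m) \<in> mpolys_in K (V - {i})"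
      using p by (intro single_in_mpolys_in subring_set_zero[OF K]) (auto simp: mpolys_in_def)
    hence "monom (Poly_Mapping.single m' (Poly_Mapping.lookup p m)) k \<in> polys_over (mpolys_in K (V - {i}))"
      by (rule polys_over_monom[OF sub])
    moreover have "poly (monom (Poly_Mapping.single m' (Poly_Mapping.lookup p m)) k) (mvar i)
        = Poly_Mapping.single m (Poly_Mapping.lookup p m)"
      by (simp add: poly_monom mvar_power mult_single mm'[symmetric])
    ultimately show ?thesis by blast
  qed
  then obtain q where q: "\<And>m. m \<in> Poly_Mapping.keys p \<Longrightarrow> q m \<in> polys_over (mpolys_in K (V - {i}))"
    "\<And>m. m \<in> Poly_Mapping.keys p \<Longrightarrow> poly (q m) (mvar i) = Poly_Mapping.single m (Poly_Mapping.lookup p m)"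
    by metis
  show ?thesis
  proof
    show "(\<Sum>m\<in>Poly_Mapping.keys p. q m) \<in> polys_over (mpolys_in K (V - {i}))"
      using q(1) by (intro subring_set_sum subring_set_polys_over sub)
    show "poly (\<Sum>m\<in>Poly_Mapping.keys p. q m) (mvar i) = p"
      using q(2) by (subst (2) poly_mapping_sum_single[of p]) (simp add: poly_sum)
  qed
qed

lemma poly_mvar_in_mpolys_in:
  fixes K :: "'a :: comm_ring_1 set"
  assumes K: "subring_set K" and p: "p \<in> polys_over (mpolys_in K V)"
  shows "poly p (mvar i) \<in> mpolys_in K (insert i V)"
proof (rule poly_in_subring_set)
  show "p \<in> polys_over (mpolys_in K (insert i V))"
    using p mpolys_in_mono[of K K V "insert i V"] by (auto simp: polys_over_def)
qed (auto intro: subring_set_mpolys_in mvar_in_mpolys_in K)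

section \<open>Linear algebra over subrings and ultrafilters\<close>

text \<open>Fraction-free Gaussian elimination: cross-multiplying with the pivot instead of dividing
  keeps all coefficients in \<open>R\<close>.\<close>

lemma subring_linear_dependence:
  fixes R :: "'a :: idom set" and v :: "'i \<Rightarrow> 'j \<Rightarrow> 'a"
  assumes R: "subring_set R" and "finite J" "finite I" "card J < card I"
    and "\<And>i j. i \<in> I \<Longrightarrow> j \<in> J \<Longrightarrow> v i j \<in> R"
  shows "\<exists>c. (\<forall>i\<in>I. c i \<in> R) \<and> (\<exists>i\<in>I. c i \<noteq> 0) \<and> (\<forall>j\<in>J. (\<Sum>i\<in>I. c i * v i j) = 0)"
  using assms(2-)
proof (induction J arbitrary: I v rule: finite_induct)
  case empty
  thus ?case
    by (intro exI[of _ "\<lambda>_. 1"]) (auto simp: card_gt_0_iff subring_set_one[OF R])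
next
  case (insert j0 J)
  show ?case
  proof (cases "\<forall>i\<in>I. v i j0 = 0")
    case True
    moreover have "card J < card I"
      using insert by simp
    ultimately show ?thesis
      using insert.IH[of I v] insert.prems by simp
  next
    case False
    then obtain k where k: "k \<in> I" "v k j0 \<noteq> 0" by auto
    \<comment> \<open>The rows with their entry in column \<open>j0\<close> cleared by the pivot row
      \<open>k\<close>.\<close>
    define w where "w = (\<lambda>i j. v k j0 * v i j - v i j0 * v k j)"
    have "card J < card (I - {k})"
      using insert k by (simp add: card_Diff_singleton)
    moreover have "w i j \<in> R" if "i \<in> I - {k}" "j \<in> J" for i j
      using that k insert.prems unfolding w_def by (auto intro!: subring_set_intros R)
    ultimately obtain c where c: "\<forall>i\<in>I - {k}. c i \<in> R" "\<exists>i\<in>I - {k}. c i \<noteq> 0"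
      "\<forall>j\<in>J. (\<Sum>i\<in>I - {k}. c i * w i j) = 0"
      using insert.IH[of "I - {k}" w] insert.prems by auto
    \<comment> \<open>Expanding \<open>w\<close> in a dependence among its rows and collecting the
      multiples of row \<open>k\<close> gives these coefficients.\<close>
    define c' where "c' = (\<lambda>i. if i = k then - (\<Sum>i\<in>I - {k}. c i * v i j0) else v k j0 * c i)"
    have "(\<Sum>i\<in>I. c' i * v i j) = (\<Sum>i\<in>I - {k}. c i * w i j)" for j
    proof -
      have "(\<Sum>i\<in>I. c' i * v i j) = c' k * v k j + (\<Sum>i\<in>I - {k}. c' i * v i j)"
        using k insert.prems by (intro sum.remove) auto
      also have "(\<Sum>i\<in>I - {k}. c' i * v i j) = (\<Sum>i\<in>I - {k}. v k j0 * c i * v i j)"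
        by (intro sum.cong) (auto simp: c'_def)
      also have "c' k * v k j + \<dots> = (\<Sum>i\<in>I - {k}. c i * w i j)"
        by (simp add: c'_def w_def sum_distrib_right sum_distrib_left algebra_simps sum_subtractf)
      finally show ?thesis .
    qed
    moreover have "(\<Sum>i\<in>I - {k}. c i * w i j0) = 0"
      by (simp add: w_def mult.commute)
    ultimately have "\<forall>j\<in>insert j0 J. (\<Sum>i\<in>I. c' i * v i j) = 0"
      using c(3) by auto
    moreover have "\<forall>i\<in>I. c' i \<in> R"
      using c(1) insert.prems k by (auto simp: c'_def intro!: subring_set_intros R)
    moreover have "\<exists>i\<in>I. c' i \<noteq> 0"
      using c(2) k by (auto simp: c'_def)
    ultimately show ?thesis by blast
  qed
qed

text \<open>Fraction-free form of: an element that maps a finitely generated module into itself is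
  algebraic.\<close>

lemma algebraic_relation:
  fixes \<eta> :: "'s \<Rightarrow> 'r :: idom \<Rightarrow> 'k :: comm_ring_1" and h :: "'s \<Rightarrow> 'k" and b :: "'s \<Rightarrow> 'i \<Rightarrow> 'k"
  assumes R: "subring_set R" and \<eta>: "\<And>s. s \<in> S \<Longrightarrow> ring_hom_fun (\<eta> s)"
    and fin: "finite I" and i0: "i0 \<in> I" and d: "d \<in> R" "d \<noteq> 0"
    and M: "\<And>i j. i \<in> I \<Longrightarrow> j \<in> I \<Longrightarrow> M i j \<in> R"
    and rel: "\<And>s i. s \<in> S \<Longrightarrow> i \<in> I \<Longrightarrow> \<eta> s d * h s * b s i = (\<Sum>j\<in>I. \<eta> s (M i j) * b s j)"
  obtains F where "F \<in> polys_over R" "F \<noteq> 0"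
    "\<And>s. s \<in> S \<Longrightarrow> poly (map_poly (\<eta> s) F) (h s) * b s i0 = 0"
proof -
  \<comment> \<open>\<open>V k\<close> is row \<open>i0\<close> of the \<open>k\<close>-th power of
    the matrix \<open>M\<close>.\<close>
  define V where "V = rec_nat (\<lambda>j. if j = i0 then 1 else 0) (\<lambda>_ x j. \<Sum>i\<in>I. x i * M i j)"
  have V_0: "V 0 j = (if j = i0 then 1 else 0)" and V_Suc: "V (Suc k) j = (\<Sum>i\<in>I. V k i * M i j)" for j k
    by (simp_all add: V_def)
  have V: "V k j \<in> R" if "j \<in> I" for k j
    using that by (induction k arbitrary: j) (auto simp: V_0 V_Suc intro!: subring_set_intros R M)
  have pow: "\<eta> s d ^ k * h s ^ k * b s i0 = (\<Sum>j\<in>I. \<eta> s (V k j) * b s j)" if s: "s \<in> S" for s k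
  proof (induction k)
    case 0
    have "(\<Sum>j\<in>I. \<eta> s (V 0 j) * b s j) = (\<Sum>j\<in>I. if j = i0 then b s j else 0)"
      by (intro sum.cong) (auto simp: V_0 ring_hom_fun_simps[OF \<eta>[OF s]])
    thus ?case using fin i0 by simp
  next
    case (Suc k)
    have "\<eta> s d ^ Suc k * h s ^ Suc k * b s i0 = \<eta> s d * h s * (\<eta> s d ^ k * h s ^ k * b s i0)"
      by (simp add: mult_ac)
    also have "\<dots> = \<eta> s d * h s * (\<Sum>i\<in>I. \<eta> s (V k i) * b s i)"
      by (simp only: Suc)
    also have "\<dots> = (\<Sum>i\<in>I. \<eta> s (V k i) * (\<eta> s d * h s * b s i))"
      by (simp add: sum_distrib_left mult_ac)
    also have "\<dots> = (\<Sum>i\<in>I. \<Sum>j\<in>I. \<eta> s (V k i) * \<eta> s (M i j) * b s j)"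
      using rel[OF s] by (intro sum.cong) (auto simp: sum_distrib_left mult_ac)
    also have "\<dots> = (\<Sum>j\<in>I. \<eta> s (V (Suc k) j) * b s j)"
      by (subst sum.swap) (simp add: V_Suc ring_hom_fun_simps[OF \<eta>[OF s]] sum_distrib_right)
    finally show ?case .
  qed
  \<comment> \<open>There are \<open>card I + 1\<close> powers but only \<open>card I\<close>
    coordinates, so the rows are dependent.\<close>
  obtain c where c: "\<forall>k\<in>{..card I}. c k \<in> R" "\<exists>k\<in>{..card I}. c k \<noteq> 0"
    "\<forall>j\<in>I. (\<Sum>k\<in>{..card I}. c k * V k j) = 0"
    using subring_linear_dependence[OF R fin, of "{..card I}" V] V by auto
  \<comment> \<open>The factor \<open>d ^ k\<close> absorbs the denominators accumulated in the
    \<open>k\<close>-th power.\<close>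
  define F where "F = (\<Sum>k\<le>card I. monom (c k * d ^ k) k)"
  have coeff: "coeff F k = (if k \<le> card I then c k * d ^ k else 0)" for k
    by (simp add: F_def coeff_sum)
  show ?thesis
  proof
    show "F \<in> polys_over R"
      using c(1) d by (auto simp: polys_over_def coeff intro!: subring_set_intros R)
    obtain k where "k \<le> card I" "c k \<noteq> 0"
      using c(2) by auto
    hence "coeff F k \<noteq> 0"
      using d by (simp add: coeff)
    thus "F \<noteq> 0" by auto
    show "poly (map_poly (\<eta> s) F) (h s) * b s i0 = 0" if s: "s \<in> S" for s
    proof -
      note hom = ring_hom_fun_simps[OF \<eta>[OF s]]
      have "poly (map_poly (\<eta> s) F) (h s) = (\<Sum>k\<le>card I. \<eta> s (c k) * (\<eta> s d ^ k * h s ^ k))"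
        by (simp add: F_def ring_hom_fun_sum[OF ring_hom_fun_map_poly[OF \<eta>[OF s]]] map_poly_monom
            poly_sum poly_monom hom mult_ac)
      hence "poly (map_poly (\<eta> s) F) (h s) * b s i0
          = (\<Sum>k\<le>card I. \<eta> s (c k) * (\<eta> s d ^ k * h s ^ k * b s i0))"
        by (simp add: sum_distrib_right mult.assoc)
      also have "\<dots> = (\<Sum>k\<le>card I. \<eta> s (c k) * (\<Sum>j\<in>I. \<eta> s (V k j) * b s j))"
        by (simp only: pow[OF s])
      also have "\<dots> = (\<Sum>j\<in>I. \<eta> s (\<Sum>k\<le>card I. c k * V k j) * b s j)"
        by (simp add: sum_distrib_left sum_distrib_right hom mult_ac, subst sum.swap, rule refl)
      also have "\<dots> = 0"
        using c(3) by (simp add: hom)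
      finally show ?thesis .
    qed
  qed
qed

definition subfield_set :: "'a :: Fields.field set \<Rightarrow> bool" where
  "subfield_set L \<longleftrightarrow> subring_set L \<and> (\<forall>x\<in>L. inverse x \<in> L)"

text \<open>Greedy extraction of a basis of the \<open>L\<close>-span of \<open>C\<close>. It will
  split the coefficients of a polynomial over the whole field into components over
  \<open>L\<close>.\<close>

lemma finite_basis_over_subfield:
  fixes L :: "'a :: Fields.field set"
  assumes L: "subfield_set L" and "finite C"
  shows "\<exists>B. finite B \<and> (\<forall>c\<in>C. \<exists>l. (\<forall>b\<in>B. l b \<in> L) \<and> c = (\<Sum>b\<in>B. l b * b))
    \<and> (\<forall>l. (\<forall>b\<in>B. l b \<in> L) \<longrightarrow> (\<Sum>b\<in>B. l b * b) = 0 \<longrightarrow> (\<forall>b\<in>B. l b = 0))"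
  using assms(2)
proof induction
  case empty
  show ?case by (intro exI[of _ "{}"]) auto
next
  case (insert c C)
  have sub: "subring_set L"
    using L by (simp add: subfield_set_def)
  obtain B where B: "finite B" "\<forall>c\<in>C. \<exists>l. (\<forall>b\<in>B. l b \<in> L) \<and> c = (\<Sum>b\<in>B. l b * b)"
    "\<forall>l. (\<forall>b\<in>B. l b \<in> L) \<longrightarrow> (\<Sum>b\<in>B. l b * b) = 0 \<longrightarrow> (\<forall>b\<in>B. l b = 0)"
    using insert.IH by (elim exE conjE) (rule that)
  show ?case
  proof (cases "\<exists>l. (\<forall>b\<in>B. l b \<in> L) \<and> c = (\<Sum>b\<in>B. l b * b)")
    case True
    thus ?thesis using B by (intro exI[of _ B] conjI ballI) auto
  next
    case False
    have "c \<notin> B"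
    proof
      assume "c \<in> B"
      hence "(\<Sum>b\<in>B. of_bool (b = c) * b) = c"
        using B(1) by (simp add: of_bool_def if_distrib[of "\<lambda>x. x * _"] cong: if_cong)
      thus False
        using spec[OF False[unfolded not_ex], of "\<lambda>b. of_bool (b = c)"]
          subring_set_one[OF sub] subring_set_zero[OF sub] by (auto simp: of_bool_def split: if_splits)
    qed
    have sum_ins: "(\<Sum>b\<in>insert c B. l b * b) = l c * c + (\<Sum>b\<in>B. l b * b)" for l
      using B(1) \<open>c \<notin> B\<close> by simp
    have "\<exists>l. (\<forall>b\<in>insert c B. l b \<in> L) \<and> c' = (\<Sum>b\<in>insert c B. l b * b)" if c': "c' \<in> insert c C" for c'
    proof (cases "c' = c")
      case True
      have "(\<Sum>b\<in>B. (if b = c then 1 else 0) * b) = 0"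
        using \<open>c \<notin> B\<close> by (intro sum.neutral) auto
      thus ?thesis
        using True subring_set_one[OF sub] subring_set_zero[OF sub] unfolding sum_ins
        by (intro exI[of _ "\<lambda>b. if b = c then 1 else 0"]) simp
    next
      case False
      then obtain l where l: "\<forall>b\<in>B. l b \<in> L" "c' = (\<Sum>b\<in>B. l b * b)"
        using B(2) c' by auto
      have "(\<Sum>b\<in>B. (l(c := 0)) b * b) = (\<Sum>b\<in>B. l b * b)"
        using \<open>c \<notin> B\<close> by (intro sum.cong) auto
      thus ?thesis
        using l subring_set_zero[OF sub] unfolding sum_ins by (intro exI[of _ "l(c := 0)"]) simp
    qed
    moreover have "l b = 0" if l: "\<forall>b\<in>insert c B. l b \<in> L" "(\<Sum>b\<in>insert c B. l b * b) = 0"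
      and b: "b \<in> insert c B" for l b
    proof -
      \<comment> \<open>Otherwise division by \<open>l c\<close> would put \<open>c\<close> into the
        span of \<open>B\<close>.\<close>
      have "l c = 0"
      proof (rule ccontr)
        assume "l c \<noteq> 0"
        have "l c * c = - (\<Sum>b\<in>B. l b * b)"
          using l(2) unfolding sum_ins by (simp add: add_eq_0_iff2)
        hence "c = - inverse (l c) * (\<Sum>b\<in>B. l b * b)"
          using \<open>l c \<noteq> 0\<close> by (simp add: field_simps)
        also have "\<dots> = (\<Sum>b\<in>B. - inverse (l c) * l b * b)"
          by (simp add: sum_distrib_left mult_ac)
        finally have "c = (\<Sum>b\<in>B. - inverse (l c) * l b * b)" .
        moreover have "\<forall>b\<in>B. - inverse (l c) * l b \<in> L"
          using l L by (auto simp: subfield_set_def intro!: subring_set_uminus subring_set_mult)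
        ultimately show False
          using spec[OF False[unfolded not_ex], of "\<lambda>b. - inverse (l c) * l b"] by simp
      qed
      thus ?thesis
        using B(3)[rule_format, of l b] l b unfolding sum_ins by auto
    qed
    ultimately show ?thesis
      using B(1) by (intro exI[of _ "insert c B"] conjI ballI allI impI) auto
  qed
qed

section \<open>Ultrafilters\<close>

definition ultrafilter :: "'a filter \<Rightarrow> bool" where
  "ultrafilter U \<longleftrightarrow> U \<noteq> bot \<and> (\<forall>P. eventually P U \<or> eventually (\<lambda>x. \<not> P x) U)"

text \<open>Zorn's lemma for proper filters ordered by refinement.\<close>

lemma ex_ultrafilter_le:
  assumes "F \<noteq> bot"
  obtains U where "ultrafilter U" "U \<le> F"
proof -
  define A where "A = {G. G \<noteq> bot \<and> G \<le> F}"
  define below where "below = (\<lambda>G H :: 'a filter. H \<le> G)"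
  have "\<exists>m\<in>A. \<forall>a\<in>A. below m a \<longrightarrow> a = m"
  proof (rule predicate_Zorn)
    show "partial_order_on A (relation_of below A)"
      by (rule partial_order_on_relation_ofI) (auto simp: below_def)
    fix C assume C: "C \<in> Chains (relation_of below A)"
    hence C': "C \<subseteq> A" "\<And>G H. G \<in> C \<Longrightarrow> H \<in> C \<Longrightarrow> G \<le> H \<or> H \<le> G"
      by (auto simp: Chains_def relation_of_def below_def)
    show "\<exists>u\<in>A. \<forall>a\<in>C. below a u"
    proof (cases "C = {}")
      case True
      thus ?thesis using assms by (auto simp: A_def)
    next
      case False
      \<comment> \<open>A chain is a filter base, so its infimum is improper only if some member
        is.\<close>
      have "eventually (\<lambda>_. False) (Inf C) \<longleftrightarrow> (\<exists>G\<in>C. eventually (\<lambda>_. False) G)"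
      proof (rule eventually_Inf_base[OF False])
        show "\<exists>x\<in>C. x \<le> inf G H" if "G \<in> C" "H \<in> C" for G H
          using C'(2)[OF that] that by (elim disjE) (auto intro: bexI[of _ G] bexI[of _ H])
      qed
      hence "Inf C \<noteq> bot"
        using C'(1) by (auto simp: A_def trivial_limit_def)
      moreover obtain G where "G \<in> C" using False by auto
      hence "Inf C \<le> F"
        using C'(1) Inf_lower[of G C] by (auto simp: A_def intro: order.trans)
      ultimately show ?thesis
        by (intro bexI[of _ "Inf C"]) (auto simp: A_def below_def Inf_lower)
    qed
  qed
  then obtain U where U: "U \<noteq> bot" "U \<le> F" "\<And>G. G \<noteq> bot \<Longrightarrow> G \<le> U \<Longrightarrow> G = U"
    unfolding A_def below_def by auto
  \<comment> \<open>By minimality, restricting \<open>U\<close> to the set where \<open>P\<close>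
    holds either changes nothing or gives the improper filter.\<close>
  have "eventually P U" if "\<not> eventually (\<lambda>x. \<not> P x) U" for P
  proof -
    have "inf U (principal {x. P x}) \<noteq> bot"
      using that by (simp add: trivial_limit_def eventually_inf_principal)
    hence "inf U (principal {x. P x}) = U"
      by (rule U(3)) simp
    moreover have "eventually P (inf U (principal {x. P x}))"
      by (simp add: eventually_inf_principal)
    ultimately show ?thesis by simp
  qed
  hence "ultrafilter U"
    using U(1) unfolding ultrafilter_def by auto
  thus ?thesis
    by (rule that[OF _ U(2)])
qed

context
  fixes U :: "'a filter"
  assumes U: "ultrafilter U"
begin

lemma ultrafilter_not_iff: "eventually (\<lambda>x. \<not> P x) U \<longleftrightarrow> \<not> eventually P U"
proof -
  have "\<not> (eventually P U \<and> eventually (\<lambda>x. \<not> P x) U)"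
    using U eventually_conj[of P U "\<lambda>x. \<not> P x"] by (auto simp: ultrafilter_def trivial_limit_def)
  thus ?thesis using U by (auto simp: ultrafilter_def)
qed

lemma ultrafilter_disj_iff: "eventually (\<lambda>x. P x \<or> Q x) U \<longleftrightarrow> eventually P U \<or> eventually Q U"
proof
  assume *: "eventually (\<lambda>x. P x \<or> Q x) U"
  show "eventually P U \<or> eventually Q U"
  proof (rule ccontr)
    assume "\<not> (eventually P U \<or> eventually Q U)"
    hence "eventually (\<lambda>x. \<not> P x) U" "eventually (\<lambda>x. \<not> Q x) U"
      by (auto simp: ultrafilter_not_iff)
    with * have "eventually (\<lambda>x. False) U"
      by eventually_elim auto
    thus False using U by (simp add: ultrafilter_def trivial_limit_def)
  qed
qed (auto elim: eventually_mono)

text \<open>A pigeonhole principle: a choice from a finite range that varies with the point can be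
  made once for all. It fixes the multiplier in the primitive element and shows that
  \<open>x\<close> is not confined to finitely many values.\<close>

lemma ultrafilter_finite_ex:
  assumes "finite I" "eventually (\<lambda>x. \<exists>i\<in>I. P i x) U"
  shows "\<exists>i\<in>I. eventually (P i) U"
  using assms
proof induction
  case empty
  thus ?case using U by (simp add: ultrafilter_def trivial_limit_def)
next
  case (insert i I)
  have "eventually (P i) U \<or> eventually (\<lambda>x. \<exists>i\<in>I. P i x) U"
    using insert.prems by (simp only: bex_simps ultrafilter_disj_iff[symmetric])
  thus ?case
    using insert.IH by (elim disjE) auto
qed

lemma ultrafilter_const_iff [simp]: "eventually (\<lambda>_. c) U \<longleftrightarrow> c"
  using U by (auto simp: ultrafilter_def trivial_limit_def)

end

section \<open>Generic points and primitive elements\<close>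

lemma pderiv_map_poly_hom:
  fixes h :: "'a :: idom \<Rightarrow> 'b :: idom"
  assumes "ring_hom_fun h"
  shows "pderiv (map_poly h p) = map_poly h (pderiv p)"
  by (rule poly_eqI)
    (simp add: coeff_pderiv coeff_map_poly ring_hom_fun_simps[OF assms] del: of_nat_Suc)

text \<open>The chain rule for \<open>G(u, x(u))\<close>: the first summand differentiates the
  coefficients in \<open>u\<close>, the second one the main variable.\<close>

lemma pderiv_poly:
  fixes G :: "'a :: idom poly poly"
  shows "pderiv (poly G x) = poly (map_poly pderiv G) x + poly (pderiv G) x * pderiv x"
proof (induction G)
  case (pCons a G)
  thus ?case
    by (simp add: pderiv_add pderiv_mult map_poly_pCons pderiv_pCons algebra_simps)
qed simp

text \<open>The sum runs up to \<open>degree p\<close> because \<open>h\<close> may kill leading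
  coefficients, and the range should not depend on \<open>h\<close>.\<close>

lemma poly_map_poly_altdef:
  fixes h :: "'a :: comm_ring_1 \<Rightarrow> 'b :: comm_ring_1"
  assumes "h 0 = 0"
  shows "poly (map_poly h p) x = (\<Sum>k\<le>degree p. h (coeff p k) * x ^ k)"
proof -
  have "poly (map_poly h p) x = (\<Sum>k\<le>degree (map_poly h p). h (coeff p k) * x ^ k)"
    by (simp add: poly_altdef coeff_map_poly assms)
  also have "\<dots> = (\<Sum>k\<le>degree p. h (coeff p k) * x ^ k)"
  proof (intro sum.mono_neutral_left ballI)
    show "{..degree (map_poly h p)} \<subseteq> {..degree p}"
      using map_poly_degree_leq[of h p] assms by simp
    show "h (coeff p k) * x ^ k = 0" if "k \<in> {..degree p} - {..degree (map_poly h p)}" for k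
      using that coeff_eq_0[of "map_poly h p" k] by (simp add: coeff_map_poly assms)
  qed auto
  finally show ?thesis .
qed

text \<open>Multiplication by a root acts on the powers below the degree through the companion
  matrix; scaling by the leading coefficient keeps its entries in \<open>R\<close>. \<open>P\<close>
  is fixed before \<open>h\<close> and \<open>x\<close>, so it serves all assignments at
  once.\<close>

lemma companion_relation:
  fixes R :: "'r :: idom set"
  assumes R: "subring_set R" and p: "p \<in> polys_over R"
  obtains P where "\<And>i k. P i k \<in> R"
    "\<And>h x i. ring_hom_fun h \<Longrightarrow> poly (map_poly h p) x = (0 :: 'k :: comm_ring_1) \<Longrightarrow> i < degree p \<Longrightarrow>
       h (lead_coeff p) * x ^ Suc i = (\<Sum>k<degree p. h (P i k) * x ^ k)"
proof
  \<comment> \<open>Rows before the last one shift the exponent; the last row solves the polynomial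
    for its top power.\<close>
  define P where "P = (\<lambda>i k. if Suc i < degree p then (if k = Suc i then lead_coeff p else 0) else - coeff p k)"
  show "P i k \<in> R" for i k
    using p by (auto simp: P_def polys_over_def intro!: subring_set_intros R)
  fix h :: "'r \<Rightarrow> 'k" and x :: 'k and i
  assume h: "ring_hom_fun h" and root: "poly (map_poly h p) x = 0" and i: "i < degree p"
  note hom = ring_hom_fun_simps[OF h]
  show "h (lead_coeff p) * x ^ Suc i = (\<Sum>k<degree p. h (P i k) * x ^ k)"
  proof (cases "Suc i < degree p")
    case True
    hence "(\<Sum>k<degree p. h (P i k) * x ^ k)
        = (\<Sum>k<degree p. if k = Suc i then h (lead_coeff p) * x ^ k else 0)"
      by (intro sum.cong) (auto simp: P_def hom)
    thus ?thesis using True by simp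
  next
    case False
    hence m: "degree p = Suc i" using i by simp
    have "0 = (\<Sum>k\<le>degree p. h (coeff p k) * x ^ k)"
      using root by (simp add: poly_map_poly_altdef hom)
    also have "\<dots> = (\<Sum>k<degree p. h (coeff p k) * x ^ k) + h (lead_coeff p) * x ^ degree p"
      by (simp add: lessThan_Suc_atMost[symmetric])
    finally have "h (lead_coeff p) * x ^ degree p = - (\<Sum>k<degree p. h (coeff p k) * x ^ k)"
      by (simp add: eq_neg_iff_add_eq_0 add.commute)
    thus ?thesis using False m by (simp add: P_def hom sum_negf)
  qed
qed

text \<open>The bound depends on \<open>G\<close> alone, so one finite range of candidates contains
  a non-root for every assignment.\<close>

lemma degree_poly_map_poly_le:
  fixes G :: "'r :: comm_ring_1 poly poly" and x :: "'k :: comm_ring_1 poly"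
  assumes "degree x \<le> 1" "h 0 = 0"
  shows "degree (poly (map_poly (map_poly h) G) x) \<le> degree G + (\<Sum>k\<le>degree G. degree (coeff G k))"
  unfolding poly_map_poly_altdef[of "map_poly h", OF map_poly_0]
proof (intro degree_sum_le finite_atMost)
  fix k assume k: "k \<in> {..degree G}"
  have "degree (map_poly h (coeff G k) * x ^ k) \<le> degree (map_poly h (coeff G k)) + degree (x ^ k)"
    by (rule degree_mult_le)
  also have "degree (x ^ k) \<le> degree x * k"
    by (rule degree_power_le)
  also have "\<dots> \<le> degree G"
    using assms(1) k by (metis atMost_iff mult_le_mono1 nat_mult_1 order.trans)
  also have "degree (map_poly h (coeff G k)) \<le> degree (coeff G k)"
    by (rule map_poly_degree_leq)
  also have "degree (coeff G k) \<le> (\<Sum>k\<le>degree G. degree (coeff G k))"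
    using k by (intro member_le_sum) auto
  finally show "degree (map_poly h (coeff G k) * x ^ k) \<le> degree G + (\<Sum>k\<le>degree G. degree (coeff G k))"
    by simp
qed

lemma ex_nat_non_root:
  fixes p :: "'a :: {idom, ring_char_0} poly"
  assumes "p \<noteq> 0" "degree p \<le> n"
  shows "\<exists>c\<le>n. poly p (of_nat c) \<noteq> 0"
proof (rule ccontr)
  assume "\<not> ?thesis"
  hence "of_nat ` {..n} \<subseteq> {x. poly p x = 0}" by auto
  hence "card (of_nat ` {..n} :: 'a set) \<le> card {x. poly p x = 0}"
    using poly_roots_finite[OF assms(1)] by (intro card_mono)
  also have "\<dots> \<le> degree p"
    using card_poly_roots_bound[OF assms(1)] .
  finally show False
    using assms(2) card_image[of "of_nat :: nat \<Rightarrow> 'a" "{..n}"] by (simp add: inj_on_def)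
qed

text \<open>An ultrafilter \<open>U\<close> on assignments plays the role of a generic point over \<open>L\<close>: statements
  about it are statements holding eventually, and \<open>eventually p = 0\<close> defines its vanishing ideal.\<close>

locale generic_point =
  fixes L :: "'a :: field_char_0 set" and U :: "(nat \<Rightarrow> 'a) filter" and e :: nat
  assumes L: "subfield_set L" and U: "ultrafilter U"
    and ev_in_L: "eventually (\<lambda>s. \<forall>i\<le>e. s i \<in> L) U"
begin

lemma subring_L: "subring_set L"
  using L by (simp add: subfield_set_def)

lemma divide_in_L: "x \<in> L \<Longrightarrow> y \<in> L \<Longrightarrow> x / y \<in> L"
  using L by (auto simp: subfield_set_def divide_inverse intro: subring_set_mult)

text \<open>Independence over \<open>L\<close> of the coordinates in \<open>T\<close>, regarded as
  elements of the ultrapower along \<open>U\<close>.\<close>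

definition alg_indep :: "nat set \<Rightarrow> bool" where
  "alg_indep T \<longleftrightarrow> (\<forall>p\<in>mpolys_in L T. p \<noteq> 0 \<longrightarrow> eventually (\<lambda>s. eval_mpoly s p \<noteq> 0) U)"

end

locale generic_point_base = generic_point +
  fixes T :: "nat set"
  assumes T_subset: "T \<subseteq> {0..e}" and T_indep: "alg_indep T"
    and T_maximal: "\<And>j. j \<le> e \<Longrightarrow> j \<notin> T \<Longrightarrow> \<not> alg_indep (insert j T)"
begin

abbreviation R :: "'a mpoly set" where "R \<equiv> mpolys_in L T"

lemma subring_R: "subring_set R"
  by (rule subring_set_mpolys_in[OF subring_L])

lemma R_nonzero: "a \<in> R \<Longrightarrow> a \<noteq> 0 \<Longrightarrow> eventually (\<lambda>s. eval_mpoly s a \<noteq> 0) U"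
  using T_indep by (auto simp: alg_indep_def)

section \<open>Germs along the ultrafilter, algebraic or rational over L(T)\<close>

definition val :: "((nat \<Rightarrow> 'a) \<Rightarrow> 'a) \<Rightarrow> 'a mpoly poly \<Rightarrow> (nat \<Rightarrow> 'a) \<Rightarrow> 'a" where
  "val h p s = poly (map_poly (eval_mpoly s) p) (h s)"

lemma val_simps [simp]:
  "val h 0 s = 0" "val h 1 s = 1" "val h (p + q) s = val h p s + val h q s"
  "val h (p - q) s = val h p s - val h q s" "val h (- p) s = - val h p s"
  "val h (p * q) s = val h p s * val h q s" "val h (pCons a p) s = eval_mpoly s a + h s * val h p s"
  unfolding val_def
  by (simp_all add: ring_hom_fun_simps[OF ring_hom_fun_map_poly[OF ring_hom_eval_mpoly]] map_poly_pCons)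

text \<open>Algebraicity over \<open>L(T)\<close> with denominators cleared. Nonzero elements of
  \<open>R\<close> are eventually nonzero, so a nonzero \<open>p\<close> stays a nontrivial relation
  eventually.\<close>

definition algebraic_germ :: "((nat \<Rightarrow> 'a) \<Rightarrow> 'a) \<Rightarrow> bool" where
  "algebraic_germ h \<longleftrightarrow> (\<exists>p\<in>polys_over R. p \<noteq> 0 \<and> eventually (\<lambda>s. val h p s = 0) U)"

text \<open>Membership of a germ \<open>g\<close> in the field \<open>L(T)(h)\<close>:\<close>

definition rational_in :: "((nat \<Rightarrow> 'a) \<Rightarrow> 'a) \<Rightarrow> ((nat \<Rightarrow> 'a) \<Rightarrow> 'a) \<Rightarrow> bool" where
  "rational_in h g \<longleftrightarrow> (\<exists>N\<in>polys_over R. \<exists>D\<in>polys_over R.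
     eventually (\<lambda>s. val h D s \<noteq> 0 \<and> g s * val h D s = val h N s) U)"

lemma rational_inI:
  "N \<in> polys_over R \<Longrightarrow> D \<in> polys_over R \<Longrightarrow>
   eventually (\<lambda>s. val h D s \<noteq> 0 \<and> g s * val h D s = val h N s) U \<Longrightarrow> rational_in h g"
  by (auto simp: rational_in_def)

lemma rational_inE:
  assumes "rational_in h g"
  obtains N D where "N \<in> polys_over R" "D \<in> polys_over R"
    "eventually (\<lambda>s. val h D s \<noteq> 0 \<and> g s * val h D s = val h N s) U"
  using assms by (auto simp: rational_in_def)

lemmas polys_over_R_intros =
  subring_set_intros[OF subring_set_polys_over[OF subring_R]] polys_over_const[OF subring_R]

lemma rational_in_R: "a \<in> R \<Longrightarrow> rational_in h (\<lambda>s. eval_mpoly s a)"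
  by (rule rational_inI[of "[:a:]" 1]) (auto intro: polys_over_R_intros)

lemma rational_in_self: "rational_in h h"
  by (rule rational_inI[of "[:0, 1:]" 1])
    (auto intro: polys_over_R_intros simp: polys_over_pCons_iff subring_set_intros subring_R
      simp flip: one_pCons)

lemma rational_in_add:
  assumes "rational_in h g" "rational_in h g'"
  shows "rational_in h (\<lambda>s. g s + g' s)"
proof -
  from assms(1) obtain N D where 1: "N \<in> polys_over R" "D \<in> polys_over R"
    "eventually (\<lambda>s. val h D s \<noteq> 0 \<and> g s * val h D s = val h N s) U" by (rule rational_inE)
  from assms(2) obtain N' D' where 2: "N' \<in> polys_over R" "D' \<in> polys_over R"
    "eventually (\<lambda>s. val h D' s \<noteq> 0 \<and> g' s * val h D' s = val h N' s) U" by (rule rational_inE)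
  show ?thesis
  proof (rule rational_inI[of "N * D' + N' * D" "D * D'"])
    show "eventually (\<lambda>s. val h (D * D') s \<noteq> 0 \<and>
        (g s + g' s) * val h (D * D') s = val h (N * D' + N' * D) s) U"
      using 1(3) 2(3) by eventually_elim (auto simp: algebra_simps)
  qed (use 1 2 in \<open>auto intro!: polys_over_R_intros\<close>)
qed

lemma rational_in_mult:
  assumes "rational_in h g" "rational_in h g'"
  shows "rational_in h (\<lambda>s. g s * g' s)"
proof -
  from assms(1) obtain N D where 1: "N \<in> polys_over R" "D \<in> polys_over R"
    "eventually (\<lambda>s. val h D s \<noteq> 0 \<and> g s * val h D s = val h N s) U" by (rule rational_inE)
  from assms(2) obtain N' D' where 2: "N' \<in> polys_over R" "D' \<in> polys_over R"
    "eventually (\<lambda>s. val h D' s \<noteq> 0 \<and> g' s * val h D' s = val h N' s) U" by (rule rational_inE)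
  show ?thesis
  proof (rule rational_inI[of "N * N'" "D * D'"])
    show "eventually (\<lambda>s. val h (D * D') s \<noteq> 0 \<and> (g s * g' s) * val h (D * D') s = val h (N * N') s) U"
      using 1(3) 2(3)
    proof eventually_elim
      case (elim s)
      have "(g s * g' s) * val h (D * D') s = (g s * val h D s) * (g' s * val h D' s)"
        by (simp add: mult_ac)
      thus ?case using elim by simp
    qed
  qed (use 1 2 in \<open>auto intro!: polys_over_R_intros\<close>)
qed

lemma rational_in_divide:
  assumes "rational_in h g" "rational_in h g'" "eventually (\<lambda>s. k s * g' s = g s \<and> g' s \<noteq> 0) U"
  shows "rational_in h k"
proof -
  from assms(1) obtain N D where 1: "N \<in> polys_over R" "D \<in> polys_over R"
    "eventually (\<lambda>s. val h D s \<noteq> 0 \<and> g s * val h D s = val h N s) U" by (rule rational_inE)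
  from assms(2) obtain N' D' where 2: "N' \<in> polys_over R" "D' \<in> polys_over R"
    "eventually (\<lambda>s. val h D' s \<noteq> 0 \<and> g' s * val h D' s = val h N' s) U" by (rule rational_inE)
  show ?thesis
  proof (rule rational_inI[of "N * D'" "D * N'"])
    show "eventually (\<lambda>s. val h (D * N') s \<noteq> 0 \<and> k s * val h (D * N') s = val h (N * D') s) U"
      using 1(3) 2(3) assms(3)
    proof eventually_elim
      case (elim s)
      have "val h N' s \<noteq> 0" using elim by (metis no_zero_divisors)
      moreover have "k s * (val h D s * val h N' s) = k s * (val h D s * (g' s * val h D' s))"
        using elim by simp
      hence "k s * (val h D s * val h N' s) = ((k s * g' s) * val h D s) * val h D' s"
        by (simp only: mult_ac)
      hence "k s * (val h D s * val h N' s) = val h N s * val h D' s"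
        using elim by simp
      ultimately show ?case using elim by simp
    qed
  qed (use 1 2 in \<open>auto intro!: polys_over_R_intros\<close>)
qed

lemma rational_in_val:
  assumes "rational_in h k" "p \<in> polys_over R"
  shows "rational_in h (val k p)"
  using assms(2)
proof (induction p)
  case 0
  show ?case
    using rational_in_R[OF subring_set_zero[OF subring_R]] by (simp add: val_def)
next
  case (pCons a p)
  hence "rational_in h (\<lambda>s. eval_mpoly s a + k s * val k p s)"
    by (intro rational_in_add rational_in_mult rational_in_R assms(1)) (auto simp: polys_over_pCons_iff)
  moreover have "val k (pCons a p) = (\<lambda>s. eval_mpoly s a + k s * val k p s)"
    by (rule ext) simp
  ultimately show ?case by simp
qed

lemma rational_in_trans:
  assumes "rational_in h k" "rational_in k g"
  shows "rational_in h g"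
proof -
  from assms(2) obtain N D where ND: "N \<in> polys_over R" "D \<in> polys_over R"
    "eventually (\<lambda>s. val k D s \<noteq> 0 \<and> g s * val k D s = val k N s) U" by (rule rational_inE)
  from ND(3) have "eventually (\<lambda>s. g s * val k D s = val k N s \<and> val k D s \<noteq> 0) U"
    by eventually_elim simp
  thus ?thesis
    by (rule rational_in_divide[OF rational_in_val[OF assms(1) ND(1)] rational_in_val[OF assms(1) ND(2)]])
qed

lemma degree_pos_if_val_eq_0:
  assumes "p \<in> polys_over R" "p \<noteq> 0" "eventually (\<lambda>s. val h p s = 0) U"
  shows "degree p > 0"
proof (rule ccontr)
  assume "\<not> degree p > 0"
  then obtain a where a: "p = [:a:]" by (auto elim: degree_eq_zeroE)
  hence "eventually (\<lambda>s. eval_mpoly s a \<noteq> 0) U"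
    using assms(1,2) by (intro R_nonzero) (auto simp: polys_over_pCons_iff)
  with assms(3) have "eventually (\<lambda>s. False) U"
    by eventually_elim (simp add: a)
  thus False using ultrafilter_const_iff[OF U] by simp
qed

text \<open>For algebraic germs \<open>y, z\<close>, also \<open>z + u y\<close> is algebraic, over \<open>L(T)(u)\<close> with a new variable
  \<open>u\<close>: multiplication by it preserves the span of the \<open>z ^ i * y ^ j\<close>.\<close>

lemma algebraic_pencil:
  assumes "algebraic_germ z" "algebraic_germ y"
  obtains F where "F \<in> polys_over (polys_over R)" "F \<noteq> 0"
    "eventually (\<lambda>s. poly (map_poly (map_poly (eval_mpoly s)) F) [:z s, y s:] = 0) U"
proof -
  obtain p where p: "p \<in> polys_over R" "p \<noteq> 0" "eventually (\<lambda>s. val z p s = 0) U"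
    using assms(1) by (auto simp: algebraic_germ_def)
  obtain q where q: "q \<in> polys_over R" "q \<noteq> 0" "eventually (\<lambda>s. val y q s = 0) U"
    using assms(2) by (auto simp: algebraic_germ_def)
  define m n where "m = degree p" and "n = degree q"
  define a b where "a = lead_coeff p" and "b = lead_coeff q"
  have mn: "m > 0" "n > 0"
    using degree_pos_if_val_eq_0 p q by (auto simp: m_def n_def)
  obtain P where P: "\<And>i k. P i k \<in> R"
    "\<And>h x i. ring_hom_fun h \<Longrightarrow> poly (map_poly h p) x = (0 :: 'a) \<Longrightarrow> i < m \<Longrightarrow>
       h a * x ^ Suc i = (\<Sum>k<m. h (P i k) * x ^ k)"
    using companion_relation[OF subring_R p(1)] unfolding m_def a_def by blast
  obtain Q where Q: "\<And>i k. Q i k \<in> R"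
    "\<And>h x i. ring_hom_fun h \<Longrightarrow> poly (map_poly h q) x = (0 :: 'a) \<Longrightarrow> i < n \<Longrightarrow>
       h b * x ^ Suc i = (\<Sum>k<n. h (Q i k) * x ^ k)"
    using companion_relation[OF subring_R q(1)] unfolding n_def b_def by blast
  have ab: "a \<in> R" "a \<noteq> 0" "b \<in> R" "b \<noteq> 0"
    using p q by (auto simp: a_def b_def polys_over_def)
  have hom: "ring_hom_fun (map_poly (eval_mpoly s))" for s :: "nat \<Rightarrow> 'a"
    by (intro ring_hom_fun_map_poly ring_hom_eval_mpoly)
  define S where "S = {s. val z p s = 0 \<and> val y q s = 0}"
  \<comment> \<open>The matrix of multiplication by \<open>a * b * (z + u * y)\<close>, with
    \<open>u\<close> as the polynomial variable: \<open>z\<close> moves the first index through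
    \<open>P\<close>, \<open>y\<close> moves the second one through \<open>Q\<close>, and
    \<open>b\<close> and \<open>a\<close> are the scalings left over.\<close>
  define M where "M = (\<lambda>(i, j) (i', j').
    (if j' = j then [:b * P i i':] else 0) + (if i' = i then [:0, a * Q j j':] else 0))"
  \<comment> \<open>The pair \<open>(0, 0)\<close> indexes the element 1 of the spanning family, so
    annihilating it means that \<open>F\<close> vanishes at \<open>z + u * y\<close>.\<close>
  obtain F where F: "F \<in> polys_over (polys_over R)" "F \<noteq> 0"
    "\<And>s. s \<in> S \<Longrightarrow> poly (map_poly (map_poly (eval_mpoly s)) F) [:z s, y s:] * [:z s ^ 0 * y s ^ 0:] = 0"
  proof (rule algebraic_relation[of "polys_over R" S "\<lambda>s. map_poly (eval_mpoly s)"
        "{..<m} \<times> {..<n}" "(0, 0)" "[:a * b:]" M "\<lambda>s. [:z s, y s:]" "\<lambda>s (i, j). [:z s ^ i * y s ^ j:]"])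
    show "[:a * b:] \<in> polys_over R"
      using ab by (auto intro!: polys_over_R_intros subring_set_mult[OF subring_R])
    show "M ij kl \<in> polys_over R" for ij kl
      using ab P(1) Q(1) by (cases ij; cases kl)
        (auto simp: M_def polys_over_pCons_iff intro!: polys_over_R_intros subring_set_intros subring_R)
    fix s ij assume s: "s \<in> S" and "ij \<in> {..<m} \<times> {..<n}"
    then obtain i j where ij: "ij = (i, j)" "i < m" "j < n" by auto
    let ?e = "eval_mpoly s" and ?z = "z s" and ?y = "y s"
    have zi: "?e a * ?z ^ Suc i = (\<Sum>k<m. ?e (P i k) * ?z ^ k)"
      using s ij by (intro P(2) ring_hom_eval_mpoly) (auto simp: S_def val_def)
    have yj: "?e b * ?y ^ Suc j = (\<Sum>k<n. ?e (Q j k) * ?y ^ k)"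
      using s ij by (intro Q(2) ring_hom_eval_mpoly) (auto simp: S_def val_def)
    have "(\<Sum>kl\<in>{..<m} \<times> {..<n}. map_poly ?e (M ij kl) * (case kl of (k, l) \<Rightarrow> [:?z ^ k * ?y ^ l:]))
        = (\<Sum>k<m. \<Sum>l<n. map_poly ?e (M (i, j) (k, l)) * [:?z ^ k * ?y ^ l:])"
      by (subst sum.cartesian_product, intro sum.cong) (auto simp: ij)
    also have "\<dots> = (\<Sum>k<m. \<Sum>l<n. (if l = j then [:?e b * ?e (P i k) * (?z ^ k * ?y ^ j):] else 0)
        + (if k = i then [:0, ?e a * ?e (Q j l) * (?z ^ i * ?y ^ l):] else 0))"
      unfolding M_def prod.case ring_hom_fun_add[OF hom]
      by (intro sum.cong refl) (simp add: map_poly_pCons mult_ac)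
    also have "\<dots> = (\<Sum>k<m. [:?e b * ?e (P i k) * (?z ^ k * ?y ^ j):])
        + (\<Sum>l<n. [:0, ?e a * ?e (Q j l) * (?z ^ i * ?y ^ l):])"
    proof -
      have "(\<Sum>k<m. \<Sum>l<n. if k = i then [:0, ?e a * ?e (Q j l) * (?z ^ i * ?y ^ l):] else 0)
          = (\<Sum>l<n. [:0, ?e a * ?e (Q j l) * (?z ^ i * ?y ^ l):])"
        using ij by (subst sum.swap) simp
      thus ?thesis
        using ij by (simp add: sum.distrib)
    qed
    also have "\<dots> = [:?e b * ?y ^ j * (\<Sum>k<m. ?e (P i k) * ?z ^ k):]
        + [:0, ?e a * ?z ^ i * (\<Sum>l<n. ?e (Q j l) * ?y ^ l):]"
      by (rule poly_eqI) (simp add: coeff_sum coeff_pCons sum_distrib_left mult_ac split: nat.splits)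
    also have "\<dots> = map_poly ?e [:a * b:] * [:?z, ?y:] * [:?z ^ i * ?y ^ j:]"
      unfolding zi[symmetric] yj[symmetric] by (simp add: map_poly_pCons mult_ac)
    finally show "map_poly ?e [:a * b:] * [:?z, ?y:] * (case ij of (i, j) \<Rightarrow> [:?z ^ i * ?y ^ j:])
        = (\<Sum>kl\<in>{..<m} \<times> {..<n}. map_poly ?e (M ij kl) * (case kl of (k, l) \<Rightarrow> [:?z ^ k * ?y ^ l:]))"
      by (simp add: ij)
  qed (use mn ab subring_set_polys_over[OF subring_R] hom in simp_all)
  have "eventually (\<lambda>s. s \<in> S) U"
    using p(3) q(3) by eventually_elim (simp add: S_def)
  hence "eventually (\<lambda>s. poly (map_poly (map_poly (eval_mpoly s)) F) [:z s, y s:] = 0) U"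
    by eventually_elim (use F(3) in \<open>simp add: pCons_one\<close>)
  thus ?thesis by (rule that[OF F(1,2)])
qed

end

section \<open>Primitive elements\<close>

context generic_point_base
begin

lemma val_smult [simp]: "val h (smult a p) s = eval_mpoly s a * val h p s"
  using val_simps(6)[of h "[:a:]" p s] by simp

text \<open>Take \<open>F(u, W)\<close> of least degree in \<open>W\<close> with
  \<open>F(u, z + u * y) = 0\<close>. Differentiating in \<open>u\<close> gives
  \<open>F_u + y * F_W = 0\<close> at \<open>W = z + u * y\<close>, where \<open>F_W\<close> does
  not vanish by minimality. Specializing \<open>u\<close> to a suitable \<open>c\<close> exhibits
  \<open>y\<close> as a quotient. In the proof \<open>F1\<close> is \<open>F_W\<close> and
  \<open>F2\<close> is \<open>F_u\<close>.\<close>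

lemma primitive_step:
  assumes "algebraic_germ z" "algebraic_germ y"
  obtains c :: nat where "algebraic_germ (\<lambda>s. z s + of_nat c * y s)"
    "rational_in (\<lambda>s. z s + of_nat c * y s) y"
proof -
  define \<eta> where "\<eta> = (\<lambda>s :: nat \<Rightarrow> 'a. map_poly (eval_mpoly s))"
  have \<eta>: "ring_hom_fun (\<eta> s)" for s
    unfolding \<eta>_def by (intro ring_hom_fun_map_poly ring_hom_eval_mpoly)
  define pencil where "pencil = (\<lambda>F s. poly (map_poly (\<eta> s) F) [:z s, y s:])"
  define rel where "rel = (\<lambda>F. F \<in> polys_over (polys_over R) \<and> F \<noteq> 0 \<and> eventually (\<lambda>s. pencil F s = 0) U)"
  obtain F0 where "rel F0"
    using algebraic_pencil[OF assms] unfolding rel_def pencil_def \<eta>_def by blast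
  then obtain F where F: "rel F" and F_min: "\<And>G. rel G \<Longrightarrow> degree F \<le> degree G"
    using ex_has_least_nat[of rel F0 degree] by auto
  have F': "F \<in> polys_over (polys_over R)" "F \<noteq> 0" "eventually (\<lambda>s. pencil F s = 0) U"
    using F by (auto simp: rel_def)
  \<comment> \<open>A relation of degree 0 would be a nonzero polynomial in \<open>u\<close> over
    \<open>R\<close> with value zero, against the independence of \<open>T\<close>.\<close>
  have "degree F \<noteq> 0"
  proof
    assume "degree F = 0"
    then obtain G where G: "F = [:G:]" by (auto elim: degree_eq_zeroE)
    have "G \<in> polys_over R" "G \<noteq> 0"
      using F' by (auto simp: G polys_over_pCons_iff)
    hence "eventually (\<lambda>s. eval_mpoly s (lead_coeff G) \<noteq> 0) U"
      by (intro R_nonzero) (auto simp: polys_over_def)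
    with F'(3) have "eventually (\<lambda>s. False) U"
    proof eventually_elim
      case (elim s)
      have "\<eta> s G = 0"
        using elim by (simp add: pencil_def G map_poly_pCons ring_hom_fun_simps[OF \<eta>])
      hence "coeff (\<eta> s G) (degree G) = 0" by simp
      thus ?case using elim by (simp add: \<eta>_def coeff_map_poly)
    qed
    thus False using ultrafilter_const_iff[OF U] by simp
  qed
  define F1 where "F1 = pderiv F"
  define F2 where "F2 = map_poly pderiv F"
  have F1: "F1 \<in> polys_over (polys_over R)"
    unfolding F1_def using F'(1) by (intro pderiv_in_polys_over subring_set_polys_over subring_R)
  have F2: "F2 \<in> polys_over (polys_over R)"
    unfolding F2_def using F'(1) by (rule map_poly_in_polys_over) (auto intro: pderiv_in_polys_over subring_R)
  have "F1 \<noteq> 0" "degree F1 < degree F"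
    using \<open>degree F \<noteq> 0\<close> by (auto simp: F1_def pderiv_eq_0_iff degree_pderiv)
  hence "\<not> eventually (\<lambda>s. pencil F1 s = 0) U"
    using F_min[of F1] F1 by (auto simp: rel_def)
  hence "eventually (\<lambda>s. pencil F1 s \<noteq> 0) U"
    by (simp add: ultrafilter_not_iff[OF U])
  note F1_nz = this
  \<comment> \<open>Bounds the degree in \<open>u\<close> of \<open>pencil F1 s\<close> uniformly in
    \<open>s\<close>. Each \<open>s\<close> thus admits some \<open>c\<close> up to
    \<open>n\<close>, and the ultrafilter makes the choice uniform.\<close>
  define n where "n = degree F1 + (\<Sum>k\<le>degree F1. degree (coeff F1 k))"
  from F1_nz have "eventually (\<lambda>s. \<exists>c\<in>{..n}. poly (pencil F1 s) (of_nat c) \<noteq> 0) U"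
  proof (rule eventually_mono)
    fix s assume "pencil F1 s \<noteq> 0"
    moreover have "degree (pencil F1 s) \<le> n"
      unfolding pencil_def n_def \<eta>_def by (rule degree_poly_map_poly_le) auto
    ultimately show "\<exists>c\<in>{..n}. poly (pencil F1 s) (of_nat c) \<noteq> 0"
      using ex_nat_non_root[of "pencil F1 s" n] by auto
  qed
  then obtain c where c: "eventually (\<lambda>s. poly (pencil F1 s) (of_nat c) \<noteq> 0) U"
    using ultrafilter_finite_ex[OF U finite_atMost, of n "\<lambda>c s. poly (pencil F1 s) (of_nat c) \<noteq> 0"] by auto
  define w where "w = (\<lambda>s. z s + of_nat c * y s)"
  \<comment> \<open>The specialization \<open>u = c\<close>, which turns the pencil into the single
    germ \<open>w\<close>.\<close>
  define spec where "spec = (\<lambda>G :: 'a mpoly poly. poly G (of_nat c))"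
  have spec: "ring_hom_fun spec" and spec': "ring_hom_fun (\<lambda>G :: 'a poly. poly G (of_nat c))"
    by (auto simp: spec_def ring_hom_fun_def)
  have val_spec: "val w (map_poly spec G) s = poly (pencil G s) (of_nat c)" for G s
  proof -
    have "poly (pencil G s) (of_nat c) = poly (map_poly (\<lambda>G. poly G (of_nat c)) (map_poly (\<eta> s) G)) (w s)"
      unfolding pencil_def ring_hom_fun_poly[OF spec'] by (simp add: w_def)
    also have "map_poly (\<lambda>G. poly G (of_nat c)) (map_poly (\<eta> s) G) = map_poly (eval_mpoly s) (map_poly spec G)"
      by (rule poly_eqI)
        (simp add: coeff_map_poly ring_hom_fun_simps[OF \<eta>] spec_def eval_mpoly_poly \<eta>_def)
    finally show ?thesis by (simp add: val_def)
  qed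
  have spec_in: "map_poly spec G \<in> polys_over R" if "G \<in> polys_over (polys_over R)" for G
    using that by (rule map_poly_in_polys_over)
      (auto simp: spec_def intro!: poly_in_subring_set subring_set_intros subring_R)
  have D: "eventually (\<lambda>s. val w (map_poly spec F1) s \<noteq> 0) U"
    using c by (simp add: val_spec)
  \<comment> \<open>If specialization killed \<open>F\<close>, it would also kill the derivative
    \<open>F1\<close>, contradicting \<open>D\<close>.\<close>
  have "map_poly spec F \<noteq> 0"
  proof
    assume "map_poly spec F = 0"
    hence "map_poly spec F1 = 0"
      unfolding F1_def pderiv_map_poly_hom[OF spec, symmetric] by simp
    thus False
      using D ultrafilter_const_iff[OF U] by simp
  qed
  moreover have "eventually (\<lambda>s. val w (map_poly spec F) s = 0) U"
    using F'(3) by eventually_elim (simp add: val_spec)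
  ultimately have "algebraic_germ w"
    using spec_in[OF F'(1)] by (auto simp: algebraic_germ_def)
  moreover have "rational_in w y"
  proof (rule rational_inI[of "- map_poly spec F2" "map_poly spec F1"])
    show "eventually (\<lambda>s. val w (map_poly spec F1) s \<noteq> 0 \<and>
        y s * val w (map_poly spec F1) s = val w (- map_poly spec F2) s) U"
      using D F'(3)
    proof eventually_elim
      case (elim s)
      \<comment> \<open>The pencil of \<open>F\<close> is zero as a polynomial in \<open>u\<close>,
        so it may be differentiated before \<open>u = c\<close> is substituted.\<close>
      have "0 = pderiv (pencil F s)"
        using elim by simp
      also have "\<dots> = pencil F2 s + pencil F1 s * [:y s:]"
      proof -
        have "map_poly pderiv (map_poly (\<eta> s) F) = map_poly (\<eta> s) F2"
          by (rule poly_eqI) (simp add: F2_def coeff_map_poly ring_hom_fun_simps[OF \<eta>] \<eta>_def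
              pderiv_map_poly_hom[OF ring_hom_eval_mpoly])
        thus ?thesis
          by (simp add: pencil_def pderiv_poly pderiv_map_poly_hom[OF \<eta>] F1_def pderiv_pCons)
      qed
      finally have "poly (pencil F2 s + pencil F1 s * [:y s:]) (of_nat c) = 0"
        by simp
      hence "y s * val w (map_poly spec F1) s = - val w (map_poly spec F2) s"
        by (simp add: val_spec eq_neg_iff_add_eq_0 mult.commute add.commute)
      thus ?case using elim by simp
    qed
  qed (use spec_in F1 F2 in \<open>auto intro: polys_over_R_intros\<close>)
  ultimately show ?thesis
    unfolding w_def by (rule that)
qed

lemma coordinate_algebraic:
  assumes "j \<le> e" "j \<notin> T"
  shows "algebraic_germ (\<lambda>s. s j)"
proof -
  obtain p where p: "p \<in> mpolys_in L (insert j T)" "p \<noteq> 0" "eventually (\<lambda>s. eval_mpoly s p = 0) U"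
    using T_maximal[OF assms] ultrafilter_not_iff[OF U] by (auto simp: alg_indep_def)
  obtain p' where p': "p' \<in> polys_over (mpolys_in L (T - {j}))" "poly p' (mvar j) = p"
    using mpolys_in_insert_eq[OF subring_L p(1)] by metis
  have "eventually (\<lambda>s. val (\<lambda>s. s j) p' s = 0) U"
    using p(3) by eventually_elim (simp add: val_def p'(2)[symmetric] eval_mpoly_poly)
  moreover have "p' \<noteq> 0" using p p' by auto
  ultimately show ?thesis
    using p'(1) assms unfolding algebraic_germ_def by auto
qed

text \<open>Coordinates are adjoined one at a time. With natural numbers as multipliers,
  \<open>z\<close> keeps its values in \<open>L\<close> and can later be an existentially quantified
  variable.\<close>

lemma primitive_element:
  assumes "finite J" "J \<subseteq> {0..e} - T"
  shows "\<exists>z. algebraic_germ z \<and> eventually (\<lambda>s. z s \<in> L) U \<and> (\<forall>j\<in>J. rational_in z (\<lambda>s. s j))"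
  using assms
proof induction
  case empty
  have "algebraic_germ (\<lambda>_. 0)"
    unfolding algebraic_germ_def
    by (intro bexI[of _ "[:0, 1:]"])
      (auto simp: polys_over_pCons_iff intro: subring_set_intros subring_R polys_over_R_intros simp flip: one_pCons)
  thus ?case
    by (intro exI[of _ "\<lambda>_. 0"]) (auto simp: subring_set_zero[OF subring_L])
next
  case (insert j J)
  then obtain z where z: "algebraic_germ z" "eventually (\<lambda>s. z s \<in> L) U" "\<forall>j\<in>J. rational_in z (\<lambda>s. s j)"
    by auto
  have j: "algebraic_germ (\<lambda>s. s j)"
    using insert.prems by (intro coordinate_algebraic) auto
  obtain c :: nat where c: "algebraic_germ (\<lambda>s. z s + of_nat c * s j)"
    "rational_in (\<lambda>s. z s + of_nat c * s j) (\<lambda>s. s j)"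
    by (rule primitive_step[OF z(1) j])
  let ?w = "\<lambda>s. z s + of_nat c * s j"
  \<comment> \<open>The old \<open>z\<close> is the new germ minus \<open>c\<close> times coordinate
    \<open>j\<close>, so whatever was rational in \<open>z\<close> is rational in the new
    germ.\<close>
  have "of_nat (0 :: nat) - of_nat c \<in> R"
    by (intro subring_set_intros subring_R)
  hence "rational_in ?w (\<lambda>s. eval_mpoly s (of_nat 0 - of_nat c))"
    by (rule rational_in_R)
  from rational_in_add[OF rational_in_self rational_in_mult[OF this c(2)]]
  have w_z: "rational_in ?w z"
    by simp
  have "rational_in ?w (\<lambda>s. s i)" if "i \<in> J" for i
    using rational_in_trans[OF w_z] z(3) that by simp
  moreover have "eventually (\<lambda>s. ?w s \<in> L) U"
    using z(2) ev_in_L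
    by eventually_elim (use insert.prems in \<open>auto intro!: subring_set_intros subring_L\<close>)
  ultimately show ?case
    using c by (intro exI[of _ ?w]) auto
qed

end

text \<open>From now on the variable \<open>e + 1\<close> stands for the primitive element \<open>z\<close>.\<close>

locale generic_point_primitive = generic_point_base +
  fixes z :: "(nat \<Rightarrow> 'a) \<Rightarrow> 'a"
  assumes z_algebraic: "algebraic_germ z" and z_in_L: "eventually (\<lambda>s. z s \<in> L) U"
    and coordinate_rational: "\<And>j. j \<le> e \<Longrightarrow> j \<notin> T \<Longrightarrow> rational_in z (\<lambda>s. s j)"
begin

definition lift :: "(nat \<Rightarrow> 'a) \<Rightarrow> nat \<Rightarrow> 'a" where
  "lift s = s(Suc e := z s)"

abbreviation RZ :: "'a mpoly set" where "RZ \<equiv> mpolys_in L (insert (Suc e) T)"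

lemma Suc_e_notin_T: "Suc e \<notin> T"
  using T_subset by auto

lemma subring_RZ: "subring_set RZ"
  by (rule subring_set_mpolys_in[OF subring_L])

lemma lift_in_L: "eventually (\<lambda>s. \<forall>i\<le>Suc e. lift s i \<in> L) U"
  using ev_in_L z_in_L by eventually_elim (auto simp: lift_def le_Suc_eq)

lemma eval_RZ_in_L: "p \<in> RZ \<Longrightarrow> (\<And>i. i \<le> Suc e \<Longrightarrow> v i \<in> L) \<Longrightarrow> eval_mpoly v p \<in> L"
  by (rule eval_mpoly_in[OF subring_L]) (use T_subset in auto)

lemma eval_lift:
  assumes "p \<in> polys_over R"
  shows "eval_mpoly (lift s) (poly p (mvar (Suc e))) = val z p s"
proof -
  have "map_poly (eval_mpoly (lift s)) p = map_poly (eval_mpoly s) p"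
  proof (rule poly_eqI)
    fix k
    have "eval_mpoly (lift s) (coeff p k) = eval_mpoly s (coeff p k)"
      using assms Suc_e_notin_T
      by (intro eval_mpoly_cong_in[of _ L T]) (auto simp: polys_over_def lift_def)
    thus "coeff (map_poly (eval_mpoly (lift s)) p) k = coeff (map_poly (eval_mpoly s) p) k"
      by (simp add: coeff_map_poly)
  qed
  thus ?thesis by (simp add: eval_mpoly_poly val_def lift_def)
qed

lemma RZ_cases:
  assumes "p \<in> RZ"
  obtains p' where "p' \<in> polys_over R" "p = poly p' (mvar (Suc e))"
  using mpolys_in_insert_eq[OF subring_L assms] Suc_e_notin_T by auto

lemma poly_in_RZ: "p \<in> polys_over R \<Longrightarrow> poly p (mvar (Suc e)) \<in> RZ"
  by (rule poly_mvar_in_mpolys_in[OF subring_L])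

abbreviation vanishes :: "'a mpoly \<Rightarrow> bool" where
  "vanishes p \<equiv> eventually (\<lambda>s. eval_mpoly (lift s) p = 0) U"

text \<open>Expanding the coefficients in an \<open>L\<close>-basis writes \<open>p\<close> as a
  combination of polynomials over \<open>L\<close>. At points over \<open>L\<close> their values lie
  in \<open>L\<close>, so linear independence makes each of them vanish where \<open>p\<close> does.
  They only use monomials of \<open>p\<close>, hence have no larger degrees.\<close>

lemma vanishing_descent:
  assumes p: "p \<in> mpolys_in UNIV (insert (Suc e) T)" "p \<noteq> 0" "vanishes p"
  obtains p' where "p' \<in> RZ" "p' \<noteq> 0" "vanishes p'" "Poly_Mapping.keys p' \<subseteq> Poly_Mapping.keys p"
proof -
  obtain B where B: "finite B"
    "\<forall>c\<in>Poly_Mapping.lookup p ` Poly_Mapping.keys p. \<exists>l. (\<forall>b\<in>B. l b \<in> L) \<and> c = (\<Sum>b\<in>B. l b * b)"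
    "\<forall>l. (\<forall>b\<in>B. l b \<in> L) \<longrightarrow> (\<Sum>b\<in>B. l b * b) = 0 \<longrightarrow> (\<forall>b\<in>B. l b = 0)"
    using finite_basis_over_subfield[OF L finite_imageI[OF finite_keys], of "Poly_Mapping.lookup p" p]
    by (elim exE conjE) (rule that)
  have "\<forall>m\<in>Poly_Mapping.keys p. \<exists>l. (\<forall>b\<in>B. l b \<in> L) \<and> Poly_Mapping.lookup p m = (\<Sum>b\<in>B. l b * b)"
    using B(2) by simp
  from bchoice[OF this] obtain l where l: "\<forall>m\<in>Poly_Mapping.keys p.
      (\<forall>b\<in>B. l m b \<in> L) \<and> Poly_Mapping.lookup p m = (\<Sum>b\<in>B. l m b * b)" ..
  define P where "P = (\<lambda>b. \<Sum>m\<in>Poly_Mapping.keys p. Poly_Mapping.single m (l m b))"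
  have lookup_P: "Poly_Mapping.lookup (P b) m = (if m \<in> Poly_Mapping.keys p then l m b else 0)" for b m
    by (simp add: P_def lookup_sum lookup_single when_def)
  have keys_P: "Poly_Mapping.keys (P b) \<subseteq> Poly_Mapping.keys p" for b
    by (auto simp: in_keys_iff lookup_P)
  have P_in: "P b \<in> RZ" if "b \<in> B" for b
  proof -
    have "Poly_Mapping.lookup (P b) m \<in> L" for m
      using that l subring_set_zero[OF subring_L] by (simp add: lookup_P)
    moreover have "Poly_Mapping.keys m \<subseteq> insert (Suc e) T" if "m \<in> Poly_Mapping.keys (P b)" for m
      using that keys_P[of b] p(1) unfolding mpolys_in_def by blast
    ultimately show ?thesis unfolding mpolys_in_def by blast
  qed
  have single_sum: "Poly_Mapping.single m (sum g I) = (\<Sum>b\<in>I. Poly_Mapping.single m (g b))"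
    for m :: "nat \<Rightarrow>\<^sub>0 nat" and g :: "'a \<Rightarrow> 'a" and I
    by (rule poly_mapping_eqI) (simp add: lookup_sum lookup_single when_def)
  have "p = (\<Sum>m\<in>Poly_Mapping.keys p. \<Sum>b\<in>B. Poly_Mapping.single m (l m b) * mconst b)"
  proof -
    have "Poly_Mapping.single m (Poly_Mapping.lookup p m) = (\<Sum>b\<in>B. Poly_Mapping.single m (l m b) * mconst b)"
      if "m \<in> Poly_Mapping.keys p" for m
      using that l by (simp add: single_sum mult_single)
    thus ?thesis
      by (subst poly_mapping_sum_single[of p]) (rule sum.cong[OF refl])
  qed
  also have "\<dots> = (\<Sum>b\<in>B. P b * mconst b)"
    by (subst sum.swap) (simp add: P_def sum_distrib_right)
  finally have p_eq: "p = (\<Sum>b\<in>B. P b * mconst b)" .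
  have "\<exists>b\<in>B. P b \<noteq> 0"
  proof (rule ccontr)
    assume "\<not> ?thesis"
    hence "p = 0" by (subst p_eq) simp
    thus False using p(2) by simp
  qed
  then obtain b where b: "b \<in> B" "P b \<noteq> 0" by auto
  have "vanishes (P b)"
    using p(3) lift_in_L
  proof eventually_elim
    case (elim s)
    have "(\<Sum>b\<in>B. eval_mpoly (lift s) (P b) * b) = 0"
      using elim(1) by (subst (asm) p_eq) simp
    moreover have "\<forall>b\<in>B. eval_mpoly (lift s) (P b) \<in> L"
      using elim(2) P_in by (auto intro: eval_RZ_in_L)
    ultimately show ?case
      using B(3)[rule_format, of "\<lambda>b. eval_mpoly (lift s) (P b)"] b(1) by blast
  qed
  thus ?thesis by (rule that[OF P_in[OF b(1)] b(2) _ keys_P])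
qed

text \<open>Over \<open>L(T)\<close> such an \<open>f\<close> generates the vanishing ideal. Total
  degree is left out because pseudodivision depends on the degree in \<open>z\<close> only.\<close>

definition generator :: "'a mpoly \<Rightarrow> bool" where
  "generator f \<longleftrightarrow> f \<in> RZ \<and> f \<noteq> 0 \<and> vanishes f \<and>
     (\<forall>p\<in>RZ. p \<noteq> 0 \<longrightarrow> vanishes p \<longrightarrow> degree_in {Suc e} f \<le> degree_in {Suc e} p)"

text \<open>An element of least degree in \<open>z\<close> and then of least total degree is irreducible over the whole
  field: a vanishing factor descends to \<open>L\<close> without increasing either degree.\<close>

lemma ex_irreducible_generator: "\<exists>f. generator f \<and> Factorial_Ring.irreducible f"
proof -
  define N :: "'a mpoly \<Rightarrow> nat" where "N = degree_in {Suc e}"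
  define D :: "'a mpoly \<Rightarrow> nat" where "D = degree_in (insert (Suc e) T)"
  define I where "I = (\<lambda>p. p \<in> RZ \<and> p \<noteq> 0 \<and> vanishes p)"
  obtain q where q: "q \<in> polys_over R" "q \<noteq> 0" "eventually (\<lambda>s. val z q s = 0) U"
    using z_algebraic by (auto simp: algebraic_germ_def)
  have "I (poly q (mvar (Suc e)))"
    using q poly_in_RZ degree_in_poly_mvar(2)[OF Suc_e_notin_T q(1)] by (auto simp: I_def eval_lift)
  then obtain f0 where f0: "I f0" "\<And>p. I p \<Longrightarrow> N f0 \<le> N p"
    using ex_has_least_nat[of I _ N] by blast
  \<comment> \<open>Least degree in \<open>z\<close> still allows factors from \<open>L[T]\<close>;
    least total degree excludes them.\<close>
  then obtain f where f: "I f" "N f = N f0" "\<And>p. I p \<Longrightarrow> N p = N f0 \<Longrightarrow> D f \<le> D p"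
    using ex_has_least_nat[of "\<lambda>p. I p \<and> N p = N f0" f0 D] by blast
  have gen: "generator f"
    using f f0 by (auto simp: generator_def I_def N_def)
  have fin: "finite (insert (Suc e) T)"
    using T_subset by (auto intro: finite_subset)
  \<comment> \<open>The descended \<open>p'\<close> competes with \<open>f\<close>, so
    \<open>p\<close> already has the full degree in \<open>z\<close> and then the full total degree;
    the cofactor \<open>q\<close> is left with degree 0.\<close>
  have unit: "q dvd 1" if pq: "f = p * q" and p: "vanishes p" for p q
  proof -
    have nz: "p \<noteq> 0" "q \<noteq> 0"
      using f(1) pq by (auto simp: I_def)
    have "p * q \<in> mpolys_in UNIV (insert (Suc e) T)" "q * p \<in> mpolys_in UNIV (insert (Suc e) T)"
      using f(1) pq mpolys_in_mono[of L UNIV "insert (Suc e) T"] by (auto simp: I_def mult.commute)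
    hence in_UNIV: "p \<in> mpolys_in UNIV (insert (Suc e) T)" "q \<in> mpolys_in UNIV (insert (Suc e) T)"
      using mpolys_in_UNIV_factor nz by blast+
    obtain p' where p': "p' \<in> RZ" "p' \<noteq> 0" "vanishes p'" "Poly_Mapping.keys p' \<subseteq> Poly_Mapping.keys p"
      using vanishing_descent[OF in_UNIV(1) nz(1) p] by metis
    have "I p'" using p' by (simp add: I_def)
    have deg: "N f = N p + N q" "D f = D p + D q"
      using nz by (simp_all add: N_def D_def pq degree_in_mult)
    have "N p' \<le> N p" "D p' \<le> D p"
      using p'(4) by (auto simp: N_def D_def intro: degree_in_mono)
    hence "D q = 0"
      using f0(2)[OF \<open>I p'\<close>] f(2) f(3)[OF \<open>I p'\<close>] deg by linarith
    hence keys: "m = 0" if "m \<in> Poly_Mapping.keys q" for m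
      using that in_UNIV(2) unfolding D_def degree_in_eq_0_iff[OF fin]
      by (auto simp: mpolys_in_def simp flip: keys_eq_empty)
    have "q = mconst (Poly_Mapping.lookup q 0)"
      by (rule poly_mapping_eqI) (use keys in \<open>force simp: lookup_single when_def in_keys_iff\<close>)
    then obtain c where c: "q = mconst c" ..
    moreover have "c \<noteq> 0"
      using nz(2) c by auto
    ultimately have "q * mconst (inverse c) = 1"
      by (simp add: mult_single)
    thus ?thesis by (rule dvdI[OF sym])
  qed
  have "Factorial_Ring.irreducible f"
  proof (rule irreducibleI)
    show "f \<noteq> 0" using f(1) by (simp add: I_def)
    show "\<not> f dvd 1"
    proof
      assume "f dvd 1"
      then obtain g where "1 = f * g" by (elim dvdE)
      hence "eval_mpoly v f * eval_mpoly v g = 1" for v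
        using eval_mpoly_simps(4)[of v f g] by simp
      moreover have "vanishes f" using f(1) by (simp add: I_def)
      hence "eventually (\<lambda>s. eval_mpoly (lift s) f * eval_mpoly (lift s) g = 0) U"
        by eventually_elim simp
      ultimately show False
        using ultrafilter_const_iff[OF U] by simp
    qed
    fix p q assume pq: "f = p * q"
    have "vanishes f" using f(1) by (simp add: I_def)
    \<comment> \<open>Primality of the vanishing ideal: the ultrafilter decides which factor
      vanishes.\<close>
    hence "eventually (\<lambda>s. eval_mpoly (lift s) p = 0 \<or> eval_mpoly (lift s) q = 0) U"
      by eventually_elim (simp add: pq)
    hence "vanishes p \<or> vanishes q"
      by (simp add: ultrafilter_disj_iff[OF U])
    thus "p dvd 1 \<or> q dvd 1"
      using unit[of p q] unit[of q p] pq by (auto simp: mult.commute)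
  qed
  thus ?thesis using gen by blast
qed

text \<open>By pseudodivision, on the open set where the leading coefficient \<open>a\<close> of \<open>f\<close> in \<open>z\<close> does not
  vanish, the zeros of \<open>f\<close> are zeros of every vanishing polynomial.\<close>

lemma generator_pseudodivision:
  assumes "generator f"
  obtains a where "a \<in> RZ" "\<not> vanishes a"
    "\<forall>p\<in>RZ. \<forall>v. vanishes p \<longrightarrow> eval_mpoly v f = 0 \<longrightarrow> eval_mpoly v a \<noteq> 0 \<longrightarrow> eval_mpoly v p = 0"
proof -
  let ?Z = "mvar (Suc e) :: 'a mpoly"
  have f: "f \<in> RZ" "f \<noteq> 0" "vanishes f"
    "\<And>p. p \<in> RZ \<Longrightarrow> p \<noteq> 0 \<Longrightarrow> vanishes p \<Longrightarrow> degree_in {Suc e} f \<le> degree_in {Suc e} p"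
    using assms by (auto simp: generator_def)
  obtain f' where f': "f' \<in> polys_over R" "f = poly f' ?Z"
    using RZ_cases[OF f(1)] .
  have f'_nz: "f' \<noteq> 0" using f f' by auto
  have f'_min: "degree f' \<le> degree q"
    if "q \<in> polys_over R" "q \<noteq> 0" "eventually (\<lambda>s. val z q s = 0) U" for q
    using f(4)[of "poly q ?Z"] that f' poly_in_RZ degree_in_poly_mvar[OF Suc_e_notin_T that(1)]
      degree_in_poly_mvar[OF Suc_e_notin_T f'(1)] by (simp add: eval_lift)
  have f'_van: "eventually (\<lambda>s. val z f' s = 0) U"
    using f(3) by (simp add: f' eval_lift)
  define a where "a = lead_coeff f'"
  have a: "a \<in> R" "a \<noteq> 0"
    using f' f'_nz by (auto simp: a_def polys_over_def)
  have "eventually (\<lambda>s. eval_mpoly (lift s) a \<noteq> 0) U"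
    using R_nonzero[OF a]
  proof eventually_elim
    case (elim s)
    have "eval_mpoly (lift s) a = eval_mpoly s a"
      using Suc_e_notin_T by (intro eval_mpoly_cong_in[OF a(1)]) (auto simp: lift_def)
    thus ?case using elim by simp
  qed
  hence "\<not> vanishes a"
    using ultrafilter_not_iff[OF U] by simp
  moreover have main: "eval_mpoly v (poly p ?Z) = 0"
    if "p \<in> polys_over R" "eventually (\<lambda>s. val z p s = 0) U"
      and v: "eval_mpoly v f = 0" "eval_mpoly v a \<noteq> 0" for p v
    using that(1,2)
  proof (induction "degree p" arbitrary: p rule: less_induct)
    case less
    show ?case
    proof (cases "p = 0")
      case False
      define q where "q = monom (lead_coeff p) (degree p - degree f')"
      define p1 where "p1 = [:a:] * p - q * f'"
      have q: "q \<in> polys_over R"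
        using less.prems(1) unfolding q_def by (intro polys_over_monom subring_R) (auto simp: polys_over_def)
      have p1: "p1 \<in> polys_over R"
        unfolding p1_def using q f'(1) a(1) less.prems(1) by (intro polys_over_R_intros)
      have p1_van: "eventually (\<lambda>s. val z p1 s = 0) U"
        using less.prems(2) f'_van by eventually_elim (simp add: p1_def)
      \<comment> \<open>By minimality no nonzero vanishing polynomial has degree below that of
        \<open>f'\<close>, so the reduction can only end at zero.\<close>
      have deg: "degree f' \<le> degree p"
        using f'_min less.prems False by blast
      have "eval_mpoly v (poly p1 ?Z) = 0"
      proof (cases "p1 = 0")
        case p1_nz: False
        have "coeff p1 i = 0" if "i \<ge> degree p" for i
          using that deg coeff_eq_0[of p i] coeff_eq_0[of f' "i - (degree p - degree f')"]
          by (cases "i = degree p") (auto simp: p1_def q_def a_def coeff_monom_mult)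
        hence "degree p1 < degree p"
          using p1_nz by (metis leading_coeff_0_iff not_le)
        thus ?thesis using less.hyps p1 p1_van by blast
      qed auto
      hence "eval_mpoly v a * eval_mpoly v (poly p ?Z) = 0"
        using v(1) by (simp add: p1_def f')
      thus ?thesis using v(2) by simp
    qed auto
  qed
  have "eval_mpoly v p = 0"
    if p: "p \<in> RZ" "vanishes p" "eval_mpoly v f = 0" "eval_mpoly v a \<noteq> 0" for p v
    by (rule RZ_cases[OF p(1)]) (use p main in \<open>simp add: eval_lift\<close>)
  moreover have "a \<in> RZ"
    using a(1) mpolys_in_mono[of L L T "insert (Suc e) T"] by auto
  ultimately show ?thesis by (intro that ballI allI impI)
qed

end

section \<open>Evaluating formulas at a generic point\<close>

lemma eval_term_cong: "(\<And>i. i \<in> term_vars t \<Longrightarrow> v i = w i) \<Longrightarrow> eval_term v t = eval_term w t"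
  by (induction t) auto

lemma qf_holds_cong: "(\<And>i. i \<in> qf_vars \<phi> \<Longrightarrow> v i = w i) \<Longrightarrow> qf_holds v \<phi> \<longleftrightarrow> qf_holds w \<phi>"
proof (induction \<phi>)
  case (FEq t u)
  thus ?case using eval_term_cong[of t v w] eval_term_cong[of u v w] by simp
qed auto

section \<open>Rational functions of (T, z) and truth values of formulas\<close>

context generic_point_primitive
begin

lemma not_vanishes_mult:
  assumes "\<not> vanishes p" "\<not> vanishes q"
  shows "\<not> vanishes (p * q)"
  using assms ultrafilter_disj_iff[OF U, of "\<lambda>s. eval_mpoly (lift s) p = 0" "\<lambda>s. eval_mpoly (lift s) q = 0"]
  by simp

text \<open>The identity is required wherever \<open>D\<close> is nonzero, not merely eventually,
  since it will be applied at arbitrary points of \<open>f = 0\<close>.\<close>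

definition regular :: "((nat \<Rightarrow> 'a) \<Rightarrow> 'a) \<Rightarrow> bool" where
  "regular h \<longleftrightarrow> (\<exists>N\<in>RZ. \<exists>D\<in>RZ. \<not> vanishes D \<and>
     (\<forall>v. eval_mpoly v D \<noteq> 0 \<longrightarrow> h v * eval_mpoly v D = eval_mpoly v N))"

lemma regularI:
  "N \<in> RZ \<Longrightarrow> D \<in> RZ \<Longrightarrow> \<not> vanishes D \<Longrightarrow>
   (\<And>v. eval_mpoly v D \<noteq> 0 \<Longrightarrow> h v * eval_mpoly v D = eval_mpoly v N) \<Longrightarrow> regular h"
  unfolding regular_def by blast

lemma regularE:
  assumes "regular h"
  obtains N D where "N \<in> RZ" "D \<in> RZ" "\<not> vanishes D"
    "\<forall>v. eval_mpoly v D \<noteq> 0 \<longrightarrow> h v * eval_mpoly v D = eval_mpoly v N"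
  using assms unfolding regular_def by blast

lemma regular_RZ: "p \<in> RZ \<Longrightarrow> regular (\<lambda>v. eval_mpoly v p)"
  by (rule regularI[of p 1])
    (simp_all add: subring_set_one[OF subring_RZ] ultrafilter_const_iff[OF U])

lemma regular_add:
  assumes "regular h" "regular k"
  shows "regular (\<lambda>v. h v + k v)"
proof -
  obtain N D where 1: "N \<in> RZ" "D \<in> RZ" "\<not> vanishes D"
    "\<forall>v. eval_mpoly v D \<noteq> 0 \<longrightarrow> h v * eval_mpoly v D = eval_mpoly v N"
    using assms(1) by (rule regularE)
  obtain N' D' where 2: "N' \<in> RZ" "D' \<in> RZ" "\<not> vanishes D'"
    "\<forall>v. eval_mpoly v D' \<noteq> 0 \<longrightarrow> k v * eval_mpoly v D' = eval_mpoly v N'"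
    using assms(2) by (rule regularE)
  show ?thesis
  proof (rule regularI[of "N * D' + N' * D" "D * D'"])
    fix v assume "eval_mpoly v (D * D') \<noteq> 0"
    thus "(h v + k v) * eval_mpoly v (D * D') = eval_mpoly v (N * D' + N' * D)"
      using 1(4)[rule_format, of v, symmetric] 2(4)[rule_format, of v, symmetric] by (simp add: algebra_simps)
  qed (use 1 2 not_vanishes_mult[OF 1(3) 2(3)] in \<open>auto intro!: subring_set_add subring_set_mult subring_RZ simp del: eval_mpoly_simps\<close>)
qed

lemma regular_mult:
  assumes "regular h" "regular k"
  shows "regular (\<lambda>v. h v * k v)"
proof -
  obtain N D where 1: "N \<in> RZ" "D \<in> RZ" "\<not> vanishes D"
    "\<forall>v. eval_mpoly v D \<noteq> 0 \<longrightarrow> h v * eval_mpoly v D = eval_mpoly v N"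
    using assms(1) by (rule regularE)
  obtain N' D' where 2: "N' \<in> RZ" "D' \<in> RZ" "\<not> vanishes D'"
    "\<forall>v. eval_mpoly v D' \<noteq> 0 \<longrightarrow> k v * eval_mpoly v D' = eval_mpoly v N'"
    using assms(2) by (rule regularE)
  show ?thesis
  proof (rule regularI[of "N * N'" "D * D'"])
    fix v assume "eval_mpoly v (D * D') \<noteq> 0"
    thus "h v * k v * eval_mpoly v (D * D') = eval_mpoly v (N * N')"
      using 1(4)[rule_format, of v, symmetric] 2(4)[rule_format, of v, symmetric] by (simp add: algebra_simps)
  qed (use 1 2 not_vanishes_mult[OF 1(3) 2(3)] in \<open>auto intro!: subring_set_mult subring_RZ simp del: eval_mpoly_simps\<close>)
qed

lemma regular_uminus: "regular h \<Longrightarrow> regular (\<lambda>v. - h v)"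
  using regular_mult[OF regular_RZ[of "-1"], of h]
  by (simp add: subring_set_uminus[OF subring_RZ] subring_set_one[OF subring_RZ])

lemma regular_term:
  assumes "\<And>i. i \<le> e \<Longrightarrow> regular (\<lambda>v. \<rho> v i)" "term_params t \<subseteq> L" "term_vars t \<subseteq> {0..e}"
  shows "regular (\<lambda>v. eval_term (\<rho> v) t)"
  using assms(2,3)
proof (induction t)
  case (TParam c)
  hence "mconst c \<in> RZ" by (intro mconst_in_mpolys_in subring_L) auto
  from regular_RZ[OF this] show ?case by simp
next
  case TZero
  from regular_RZ[OF subring_set_zero[OF subring_RZ]] show ?case by simp
next
  case TOne
  from regular_RZ[OF subring_set_one[OF subring_RZ]] show ?case by simp
qed (auto intro: assms(1) regular_add regular_mult regular_uminus)

text \<open>The inverse of the birational projection \<open>s \<mapsto> (T, z)\<close>.\<close>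

lemma ex_point_map:
  obtains \<rho> where "\<forall>v. \<forall>i\<in>T. \<rho> v i = v i"
    "\<forall>v. (\<forall>i\<le>Suc e. v i \<in> L) \<longrightarrow> (\<forall>i\<le>e. \<rho> v i \<in> L)"
    "eventually (\<lambda>s. \<forall>i\<le>e. \<rho> (lift s) i = s i) U" "\<forall>i\<le>e. regular (\<lambda>v. \<rho> v i)"
proof -
  define ratio where "ratio = (\<lambda>j (N, D). N \<in> RZ \<and> D \<in> RZ \<and>
    eventually (\<lambda>s. eval_mpoly (lift s) D \<noteq> 0 \<and> s j * eval_mpoly (lift s) D = eval_mpoly (lift s) N) U)"
  have "\<exists>P. j \<le> e \<and> j \<notin> T \<longrightarrow> ratio j P" for j
  proof (cases "j \<le> e \<and> j \<notin> T")
    case True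
    then obtain N D where "N \<in> polys_over R" "D \<in> polys_over R"
      "eventually (\<lambda>s. val z D s \<noteq> 0 \<and> s j * val z D s = val z N s) U"
      using coordinate_rational[of j] by (auto elim: rational_inE)
    thus ?thesis
      by (intro exI[of _ "(poly N (mvar (Suc e)), poly D (mvar (Suc e)))"])
        (simp add: ratio_def poly_in_RZ eval_lift)
  qed auto
  then obtain P where P: "\<forall>j. j \<le> e \<and> j \<notin> T \<longrightarrow> ratio j (P j)"
    using choice[of "\<lambda>j P. j \<le> e \<and> j \<notin> T \<longrightarrow> ratio j P"] by auto
  define N D where "N = (\<lambda>j. fst (P j))" and "D = (\<lambda>j. snd (P j))"
  have ND: "N j \<in> RZ" "D j \<in> RZ"
    "eventually (\<lambda>s. eval_mpoly (lift s) (D j) \<noteq> 0 \<and>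
       s j * eval_mpoly (lift s) (D j) = eval_mpoly (lift s) (N j)) U" if "j \<le> e" "j \<notin> T" for j
    using P that by (auto simp: ratio_def N_def D_def case_prod_unfold)
  \<comment> \<open>Where a denominator vanishes the quotient is 0 by convention, so points over
    \<open>L\<close> are sent to points over \<open>L\<close> without exception.\<close>
  define \<rho> where "\<rho> = (\<lambda>v i. if i \<in> T then v i else eval_mpoly v (N i) / eval_mpoly v (D i))"
  show ?thesis
  proof (rule that; (intro allI ballI impI)?)
    show "\<rho> v i = v i" if "i \<in> T" for v i
      using that by (simp add: \<rho>_def)
    show "\<rho> v i \<in> L" if v: "\<forall>i\<le>Suc e. v i \<in> L" and i: "i \<le> e" for v i
      using i ND(1,2)[of i] eval_RZ_in_L[of _ v] v
      by (auto simp: \<rho>_def intro!: divide_in_L)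
    have "eventually (\<lambda>s. \<rho> (lift s) i = s i) U" if i: "i \<le> e" for i
    proof (cases "i \<in> T")
      case True
      thus ?thesis using i by (simp add: \<rho>_def lift_def)
    next
      case False
      from ND(3)[OF i False] show ?thesis
        by eventually_elim (use False in \<open>simp add: \<rho>_def field_simps\<close>)
    qed
    hence "eventually (\<lambda>s. \<forall>i\<in>{..e}. \<rho> (lift s) i = s i) U"
      by (intro eventually_ball_finite) auto
    thus "eventually (\<lambda>s. \<forall>i\<le>e. \<rho> (lift s) i = s i) U"
      by (simp only: Ball_def atMost_iff)
    show "regular (\<lambda>v. \<rho> v i)" if i: "i \<le> e" for i
    proof (cases "i \<in> T")
      case True
      hence "mvar i \<in> RZ" by (intro mvar_in_mpolys_in subring_L) auto
      from regular_RZ[OF this] show ?thesis using True by (simp add: \<rho>_def)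
    next
      case False
      show ?thesis
      proof (rule regularI[of "N i" "D i"])
        show "\<not> vanishes (D i)"
          unfolding ultrafilter_not_iff[OF U, symmetric]
          using ND(3)[OF i False] by eventually_elim simp
        show "\<rho> v i * eval_mpoly v (D i) = eval_mpoly v (N i)" if "eval_mpoly v (D i) \<noteq> 0" for v
          using that False by (simp add: \<rho>_def)
      qed (use ND i False in auto)
    qed
  qed
qed

text \<open>On \<open>f = 0\<close>, off the zeros of \<open>g\<close>, the truth value is the
  generic one. For an equation \<open>N / D = 0\<close> there are two cases: a vanishing
  \<open>N\<close> is zero on \<open>f = 0\<close> by pseudodivision, and a non-vanishing
  \<open>N\<close> becomes a factor of \<open>g\<close>.\<close>

lemma qf_holds_generic:
  assumes f: "generator f" and \<rho>: "\<And>i. i \<le> e \<Longrightarrow> regular (\<lambda>v. \<rho> v i)"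
    and "qf_params \<phi> \<subseteq> L" "qf_vars \<phi> \<subseteq> {0..e}"
  shows "\<exists>g\<in>RZ. \<not> vanishes g \<and> (\<forall>v. eval_mpoly v f = 0 \<longrightarrow> eval_mpoly v g \<noteq> 0 \<longrightarrow>
    (qf_holds (\<rho> v) \<phi> \<longleftrightarrow> eventually (\<lambda>s. qf_holds (\<rho> (lift s)) \<phi>) U))"
  using assms(3,4)
proof (induction \<phi>)
  case (FEq t u)
  obtain a where a: "a \<in> RZ" "\<not> vanishes a"
    "\<forall>p\<in>RZ. \<forall>v. vanishes p \<longrightarrow> eval_mpoly v f = 0 \<longrightarrow> eval_mpoly v a \<noteq> 0 \<longrightarrow> eval_mpoly v p = 0"
    by (rule generator_pseudodivision[OF f])
  define h where "h = (\<lambda>v. eval_term (\<rho> v) t + - eval_term (\<rho> v) u)"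
  have h: "qf_holds (\<rho> v) (FEq t u) \<longleftrightarrow> h v = 0" for v
    by (simp add: h_def)
  have "regular h"
    unfolding h_def using FEq.prems by (intro regular_add regular_uminus regular_term \<rho>) auto
  then obtain N D where ND: "N \<in> RZ" "D \<in> RZ" "\<not> vanishes D"
    "\<forall>v. eval_mpoly v D \<noteq> 0 \<longrightarrow> h v * eval_mpoly v D = eval_mpoly v N" by (rule regularE)
  have D: "eventually (\<lambda>s. eval_mpoly (lift s) D \<noteq> 0) U"
    using ND(3) ultrafilter_not_iff[OF U] by blast
  have h_zero: "h v = 0 \<longleftrightarrow> eval_mpoly v N = 0" if "eval_mpoly v D \<noteq> 0" for v
    using ND(4)[rule_format, OF that] that by (metis mult_eq_0_iff)
  show ?case
  proof (cases "vanishes N")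
    case True
    have "eventually (\<lambda>s. h (lift s) = 0) U"
      using D True by eventually_elim (simp add: h_zero)
    moreover have "h v = 0" if "eval_mpoly v f = 0" "eval_mpoly v (a * D) \<noteq> 0" for v
      using a(3) ND(1) True that by (simp add: h_zero)
    ultimately show ?thesis
      unfolding h using not_vanishes_mult[OF a(2) ND(3)] subring_set_mult[OF subring_RZ a(1) ND(2)]
      by (intro bexI[of _ "a * D"]) simp_all
  next
    case False
    hence "eventually (\<lambda>s. eval_mpoly (lift s) N \<noteq> 0) U"
      using ultrafilter_not_iff[OF U] by blast
    with D have "eventually (\<lambda>s. \<not> h (lift s) = 0) U"
      by eventually_elim (simp add: h_zero)
    hence "\<not> eventually (\<lambda>s. h (lift s) = 0) U"
      using ultrafilter_not_iff[OF U] by blast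
    moreover have "h v \<noteq> 0" if "eval_mpoly v (N * D) \<noteq> 0" for v
      using that by (simp add: h_zero)
    ultimately show ?thesis
      unfolding h using not_vanishes_mult[OF False ND(3)] subring_set_mult[OF subring_RZ ND(1,2)]
      by (intro bexI[of _ "N * D"]) simp_all
  qed
next
  case (FNot \<phi>)
  thus ?case by (simp add: ultrafilter_not_iff[OF U])
next
  case (FAnd \<phi> \<psi>)
  obtain g where g: "g \<in> RZ" "\<not> vanishes g" "\<forall>v. eval_mpoly v f = 0 \<longrightarrow> eval_mpoly v g \<noteq> 0 \<longrightarrow>
    (qf_holds (\<rho> v) \<phi> \<longleftrightarrow> eventually (\<lambda>s. qf_holds (\<rho> (lift s)) \<phi>) U)"
    using FAnd by auto
  obtain h where h: "h \<in> RZ" "\<not> vanishes h" "\<forall>v. eval_mpoly v f = 0 \<longrightarrow> eval_mpoly v h \<noteq> 0 \<longrightarrow>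
    (qf_holds (\<rho> v) \<psi> \<longleftrightarrow> eventually (\<lambda>s. qf_holds (\<rho> (lift s)) \<psi>) U)"
    using FAnd by auto
  show ?case
    using g h not_vanishes_mult[OF g(2) h(2)] subring_set_mult[OF subring_RZ g(1) h(1)]
    by (intro bexI[of _ "g * h"]) (simp_all add: eventually_conj_iff)
next
  case (FOr \<phi> \<psi>)
  obtain g where g: "g \<in> RZ" "\<not> vanishes g" "\<forall>v. eval_mpoly v f = 0 \<longrightarrow> eval_mpoly v g \<noteq> 0 \<longrightarrow>
    (qf_holds (\<rho> v) \<phi> \<longleftrightarrow> eventually (\<lambda>s. qf_holds (\<rho> (lift s)) \<phi>) U)"
    using FOr by auto
  obtain h where h: "h \<in> RZ" "\<not> vanishes h" "\<forall>v. eval_mpoly v f = 0 \<longrightarrow> eval_mpoly v h \<noteq> 0 \<longrightarrow>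
    (qf_holds (\<rho> v) \<psi> \<longleftrightarrow> eventually (\<lambda>s. qf_holds (\<rho> (lift s)) \<psi>) U)"
    using FOr by auto
  show ?case
    using g h not_vanishes_mult[OF g(2) h(2)] subring_set_mult[OF subring_RZ g(1) h(1)]
    by (intro bexI[of _ "g * h"]) (simp_all add: ultrafilter_disj_iff[OF U])
qed

lemma ex_generic_hypersurface:
  assumes \<phi>: "qf_params \<phi> \<subseteq> L" "qf_vars \<phi> \<subseteq> {0..e}" "eventually (\<lambda>s. qf_holds s \<phi>) U" and "0 \<in> T"
  shows "\<exists>f\<in>RZ. \<exists>g\<in>RZ. Factorial_Ring.irreducible f \<and> \<not> f dvd g \<and>
    eventually (\<lambda>s. eval_mpoly (lift s) f = 0 \<and> eval_mpoly (lift s) g \<noteq> 0) U \<and>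
    (\<forall>v. (\<forall>i\<le>Suc e. v i \<in> L) \<longrightarrow> eval_mpoly v f = 0 \<longrightarrow> eval_mpoly v g \<noteq> 0 \<longrightarrow>
       (\<exists>w\<in>assignments L e (v 0). qf_holds w \<phi>))"
proof -
  obtain f where f: "generator f" "Factorial_Ring.irreducible f"
    using ex_irreducible_generator by blast
  obtain \<rho> where \<rho>: "\<forall>v. \<forall>i\<in>T. \<rho> v i = v i"
    "\<forall>v. (\<forall>i\<le>Suc e. v i \<in> L) \<longrightarrow> (\<forall>i\<le>e. \<rho> v i \<in> L)"
    "eventually (\<lambda>s. \<forall>i\<le>e. \<rho> (lift s) i = s i) U" "\<forall>i\<le>e. regular (\<lambda>v. \<rho> v i)"
    by (rule ex_point_map)
  obtain g where g: "g \<in> RZ" "\<not> vanishes g" "\<forall>v. eval_mpoly v f = 0 \<longrightarrow> eval_mpoly v g \<noteq> 0 \<longrightarrow>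
    (qf_holds (\<rho> v) \<phi> \<longleftrightarrow> eventually (\<lambda>s. qf_holds (\<rho> (lift s)) \<phi>) U)"
    using qf_holds_generic[OF f(1) _ \<phi>(1,2), of \<rho>] \<rho>(4) by auto
  have f': "f \<in> RZ" "vanishes f"
    using f(1) by (auto simp: generator_def)
  have generic: "eventually (\<lambda>s. eval_mpoly (lift s) f = 0 \<and> eval_mpoly (lift s) g \<noteq> 0) U"
    using f'(2) g(2) by (simp add: eventually_conj_iff ultrafilter_not_iff[OF U])
  have "eventually (\<lambda>s. qf_holds (\<rho> (lift s)) \<phi>) U"
    using \<phi>(3) \<rho>(3)
  proof eventually_elim
    case (elim s)
    have "qf_holds (\<rho> (lift s)) \<phi> \<longleftrightarrow> qf_holds s \<phi>"
      using elim(2) \<phi>(2) by (intro qf_holds_cong) auto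
    thus ?case using elim(1) by simp
  qed
  hence "qf_holds (\<rho> v) \<phi>" if "eval_mpoly v f = 0" "eval_mpoly v g \<noteq> 0" for v
    using g(3) that by simp
  \<comment> \<open>As 0 lies in \<open>T\<close>, the map fixes the first coordinate, so the
    solution found belongs to the same \<open>x\<close>.\<close>
  moreover have "\<rho> v \<in> assignments L e (v 0)" if "\<forall>i\<le>Suc e. v i \<in> L" for v
    using that \<rho>(1) \<rho>(2)[rule_format, of v] \<open>0 \<in> T\<close> by (auto simp: assignments_def)
  \<comment> \<open>Divisibility would make \<open>g\<close> vanish at the generic point together
    with \<open>f\<close>.\<close>
  moreover have "\<not> f dvd g"
  proof
    assume "f dvd g"
    then obtain h where "g = f * h" by (elim dvdE)
    hence "vanishes g"
      using f'(2) by (auto elim: eventually_mono)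
    thus False using g(2) by simp
  qed
  ultimately show ?thesis
    using f' f(2) g(1) generic by blast
qed

end

section \<open>From a transcendental first coordinate to a hypersurface\<close>

context generic_point
begin

text \<open>A nonzero polynomial in \<open>x\<close> alone has finitely many roots, and the
  ultrafilter would confine \<open>x\<close> to one of them.\<close>

lemma alg_indep_0:
  assumes "\<And>c. \<not> eventually (\<lambda>s. s 0 = c) U"
  shows "alg_indep {0}"
  unfolding alg_indep_def
proof (intro ballI impI)
  fix p assume p: "p \<in> mpolys_in L {0}" "p \<noteq> 0"
  obtain p' where p': "p' \<in> polys_over (mpolys_in L {})" "poly p' (mvar 0) = p"
    using mpolys_in_insert_eq[OF subring_L p(1)] by auto
  \<comment> \<open>The coefficients contain no variables, so one polynomial \<open>P\<close>, with
    one finite set of roots, serves all \<open>s\<close>.\<close>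
  define P where "P = map_poly (eval_mpoly (\<lambda>_. 0)) p'"
  have P: "map_poly (eval_mpoly s) p' = P" for s
  proof (rule poly_eqI)
    fix k
    have "eval_mpoly s (coeff p' k) = eval_mpoly (\<lambda>_. 0) (coeff p' k)"
      using p'(1) by (intro eval_mpoly_cong_in[of _ L "{}"]) (auto simp: polys_over_def)
    thus "coeff (map_poly (eval_mpoly s) p') k = coeff P k"
      by (simp add: P_def coeff_map_poly)
  qed
  have "P \<noteq> 0"
  proof
    assume "P = 0"
    define c where "c = lead_coeff p'"
    have c: "c \<noteq> 0" "c \<in> mpolys_in L {}"
      using p p' by (auto simp: c_def polys_over_def)
    have "c = mconst (Poly_Mapping.lookup c 0)"
      using c(2) by (intro poly_mapping_eqI)
        (auto simp: mpolys_in_def lookup_single when_def in_keys_iff)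
    hence "Poly_Mapping.lookup c 0 \<noteq> 0" "eval_mpoly (\<lambda>_. 0) c = Poly_Mapping.lookup c 0"
      using c(1) by (metis single_zero, metis eval_mconst)
    moreover have "coeff P (degree p') = eval_mpoly (\<lambda>_. 0) c"
      by (simp add: P_def c_def coeff_map_poly)
    ultimately show False using \<open>P = 0\<close> by simp
  qed
  hence fin: "finite {x. poly P x = 0}"
    by (rule poly_roots_finite)
  show "eventually (\<lambda>s. eval_mpoly s p \<noteq> 0) U"
  proof (rule ccontr)
    assume "\<not> ?thesis"
    hence "eventually (\<lambda>s. eval_mpoly s p = 0) U"
      by (simp add: ultrafilter_not_iff[OF U])
    hence "eventually (\<lambda>s. \<exists>c\<in>{x. poly P x = 0}. s 0 = c) U"
      by eventually_elim (simp add: p'(2)[symmetric] eval_mpoly_poly P)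
    thus False
      using ultrafilter_finite_ex[OF U fin, of "\<lambda>c s. s 0 = c"] assms by auto
  qed
qed

lemma ex_base:
  assumes "alg_indep {0}"
  obtains T where "0 \<in> T" "generic_point_base L U e T"
proof -
  define A where "A = {T. T \<subseteq> {0..e} \<and> 0 \<in> T \<and> alg_indep T}"
  have "finite A"
    by (rule finite_subset[of _ "Pow {0..e}"]) (auto simp: A_def)
  moreover have "{0} \<in> A"
    using assms by (simp add: A_def)
  ultimately obtain T where T: "T \<in> A" "\<And>T'. T' \<in> A \<Longrightarrow> T \<subseteq> T' \<Longrightarrow> T = T'"
    using finite_has_maximal[of A] by blast
  have "generic_point_base L U e T"
  proof unfold_locales
    show "\<not> alg_indep (insert j T)" if "j \<le> e" "j \<notin> T" for j
      using T(2)[of "insert j T"] T(1) that by (auto simp: A_def)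
  qed (use T in \<open>auto simp: A_def\<close>)
  thus ?thesis using that[of T] T(1) by (simp add: A_def)
qed

lemma ex_hypersurface:
  assumes "\<And>c. \<not> eventually (\<lambda>s. s 0 = c) U"
    and \<phi>: "qf_params \<phi> \<subseteq> L" "qf_vars \<phi> \<subseteq> {0..e}" "eventually (\<lambda>s. qf_holds s \<phi>) U"
  obtains f g where "f \<in> mpolys_in L {0..Suc e}" "g \<in> mpolys_in L {0..Suc e}"
    "Factorial_Ring.irreducible f" "\<not> f dvd g"
    "eventually (\<lambda>s. \<exists>v\<in>assignments L (Suc e) (s 0). eval_mpoly v f = 0 \<and> eval_mpoly v g \<noteq> 0) U"
    "\<forall>v. (\<forall>i\<le>Suc e. v i \<in> L) \<longrightarrow> eval_mpoly v f = 0 \<longrightarrow> eval_mpoly v g \<noteq> 0 \<longrightarrow>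
       (\<exists>w\<in>assignments L e (v 0). qf_holds w \<phi>)"
proof -
  obtain T where T: "0 \<in> T" "generic_point_base L U e T"
    using ex_base[OF alg_indep_0[OF assms(1)]] .
  interpret generic_point_base L U e T by fact
  obtain z where z: "algebraic_germ z" "eventually (\<lambda>s. z s \<in> L) U"
    "\<forall>j\<in>{0..e} - T. rational_in z (\<lambda>s. s j)"
    using primitive_element[of "{0..e} - T"] by auto
  interpret generic_point_primitive L U e T z
    by unfold_locales (use z in auto)
  obtain f g where fg: "f \<in> RZ" "g \<in> RZ" "Factorial_Ring.irreducible f" "\<not> f dvd g"
    "eventually (\<lambda>s. eval_mpoly (lift s) f = 0 \<and> eval_mpoly (lift s) g \<noteq> 0) U"
    "\<forall>v. (\<forall>i\<le>Suc e. v i \<in> L) \<longrightarrow> eval_mpoly v f = 0 \<longrightarrow> eval_mpoly v g \<noteq> 0 \<longrightarrow>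
       (\<exists>w\<in>assignments L e (v 0). qf_holds w \<phi>)"
    using ex_generic_hypersurface[OF \<phi> T(1)] by blast
  have sub: "RZ \<subseteq> mpolys_in L {0..Suc e}"
    using T_subset by (intro mpolys_in_mono) auto
  show ?thesis
  proof
    \<comment> \<open>The witness is \<open>lift s\<close>: the original solution with
      \<open>z s\<close> in the additional slot.\<close>
    show "eventually (\<lambda>s. \<exists>v\<in>assignments L (Suc e) (s 0). eval_mpoly v f = 0 \<and> eval_mpoly v g \<noteq> 0) U"
      using fg(5) lift_in_L
    proof eventually_elim
      case (elim s)
      thus ?case
        by (intro bexI[of _ "lift s"]) (auto simp: assignments_def lift_def)
    qed
  qed (use fg sub in auto)
qed

end

section \<open>The ultrafilter avoiding all admissible subsets\<close>

theorem theorem4p8: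
  fixes L A :: "qbar set"
  assumes "subfield L ring_of_type_algebra"
    and "A \<subseteq> L"
    and "existentially_definable L A"
  shows "\<exists>\<alpha>. (\<forall>\<beta>\<in>set \<alpha>. admissible L \<beta>) \<and> A = defined_set L \<alpha>"
proof (rule ccontr)
  assume not_good: "\<not> ?thesis"
  have L: "subfield_set L"
    using assms(1) unfolding subfield_ring_of_type_algebra_iff subfield_set_def subring_set_def by simp
  obtain e \<phi> where \<phi>: "qf_params \<phi> \<subseteq> L" "qf_vars \<phi> \<subseteq> {0..e}"
    and A: "A = {x \<in> L. \<exists>v\<in>assignments L e x. qf_holds v \<phi>}"
    using assms(3) unfolding existentially_definable_def by blast
  \<comment> \<open>By assumption \<open>A\<close> itself is not a member; concatenating
    disjunctions gives closure under unions.\<close>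
  define \<G> where "\<G> = {defined_set L \<alpha> | \<alpha>. (\<forall>\<beta>\<in>set \<alpha>. admissible L \<beta>) \<and> defined_set L \<alpha> \<subseteq> A}"
  define S where "S = {v. (\<forall>i\<le>e. v i \<in> L) \<and> qf_holds v \<phi>}"
  have S_A: "v 0 \<in> A" if "v \<in> S" for v
    using that by (auto simp: S_def A assignments_def intro!: bexI[of _ v])
  \<comment> \<open>The filter is proper because every member of \<open>\<G>\<close> misses some
    element of \<open>A\<close>, and that element comes from a solution.\<close>
  define F where "F = (INF G\<in>\<G>. principal {v \<in> S. v 0 \<notin> G})"
  have "\<not> eventually (\<lambda>_. False) F"
  proof -
    have "eventually (\<lambda>_. False) F \<longleftrightarrow> (\<exists>G\<in>\<G>. eventually (\<lambda>_. False) (principal {v \<in> S. v 0 \<notin> G}))"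
      unfolding F_def
    proof (rule eventually_INF_base)
      have "defined_set L [] \<in> \<G>"
        unfolding \<G>_def by (intro CollectI exI[of _ "[]"]) (simp add: defined_set_def)
      thus "\<G> \<noteq> {}" by blast
      fix G H assume "G \<in> \<G>" "H \<in> \<G>"
      then obtain \<alpha> \<beta> where "G = defined_set L \<alpha>" "\<forall>\<beta>\<in>set \<alpha>. admissible L \<beta>" "G \<subseteq> A"
        "H = defined_set L \<beta>" "\<forall>\<beta>\<in>set \<beta>. admissible L \<beta>" "H \<subseteq> A"
        by (auto simp: \<G>_def)
      moreover have "defined_set L (\<alpha> @ \<beta>) = defined_set L \<alpha> \<union> defined_set L \<beta>"
        by (auto simp: defined_set_def)
      ultimately have "G \<union> H \<in> \<G>"
        unfolding \<G>_def by (intro CollectI exI[of _ "\<alpha> @ \<beta>"]) auto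
      thus "\<exists>K\<in>\<G>. principal {v \<in> S. v 0 \<notin> K}
          \<le> inf (principal {v \<in> S. v 0 \<notin> G}) (principal {v \<in> S. v 0 \<notin> H})"
        by (intro bexI[of _ "G \<union> H"]) auto
    qed
    moreover have "\<not> eventually (\<lambda>_. False) (principal {v \<in> S. v 0 \<notin> G})" if "G \<in> \<G>" for G
    proof -
      have "G \<noteq> A" "G \<subseteq> A"
        using that not_good by (auto simp: \<G>_def)
      then obtain x where x: "x \<in> A" "x \<notin> G" by blast
      then obtain v where v: "v \<in> assignments L e x" "qf_holds v \<phi>"
        by (auto simp: A)
      have "v i \<in> L" if "i \<le> e" for i
        using v(1) x(1) assms(2) that by (cases "i = 0") (auto simp: assignments_def)
      hence "v \<in> S" "v 0 \<notin> G"
        using v x by (auto simp: S_def assignments_def)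
      thus ?thesis by (auto simp: eventually_principal)
    qed
    ultimately show ?thesis by blast
  qed
  hence "F \<noteq> bot"
    by (simp add: trivial_limit_def)
  then obtain U where U: "ultrafilter U" "U \<le> F"
    by (rule ex_ultrafilter_le)
  have ev_G: "eventually (\<lambda>v. v \<in> S \<and> v 0 \<notin> G) U" if "G \<in> \<G>" for G
  proof (rule filter_leD[OF U(2)])
    have "F \<le> principal {v \<in> S. v 0 \<notin> G}"
      unfolding F_def using that by (rule INF_lower)
    thus "eventually (\<lambda>v. v \<in> S \<and> v 0 \<notin> G) F"
      by (simp add: le_principal)
  qed
  have contra: "\<not> eventually (\<lambda>v. v 0 \<in> G) U" if "G \<in> \<G>" for G
  proof
    assume "eventually (\<lambda>v. v 0 \<in> G) U"
    with ev_G[OF that] have "eventually (\<lambda>v. False) U"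
      by eventually_elim simp
    thus False using ultrafilter_const_iff[OF U(1)] by simp
  qed
  have "{} \<in> \<G>"
    unfolding \<G>_def by (intro CollectI exI[of _ "[]"]) (simp add: defined_set_def)
  hence ev_S: "eventually (\<lambda>v. v \<in> S) U"
    using ev_G[of "{}"] by simp
  interpret generic_point L U e
  proof
    show "eventually (\<lambda>s. \<forall>i\<le>e. s i \<in> L) U"
      using ev_S by eventually_elim (simp add: S_def)
  qed fact+
  \<comment> \<open>A constant value \<open>c\<close> would lie in \<open>A\<close>, and the
    disjunct \<open>Point c\<close> would define a set that \<open>U\<close> avoids.\<close>
  have not_const: "\<not> eventually (\<lambda>v. v 0 = c) U" for c
  proof
    assume c: "eventually (\<lambda>v. v 0 = c) U"
    with ev_S have "eventually (\<lambda>v. c \<in> A) U"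
      by eventually_elim (use S_A in auto)
    hence "c \<in> A"
      using ultrafilter_const_iff[OF U(1)] by simp
    hence "{c} \<in> \<G>"
      unfolding \<G>_def using assms(2)
      by (intro CollectI exI[of _ "[Point c]"]) (auto simp: defined_set_def)
    from contra[OF this] c show False by simp
  qed
  have "eventually (\<lambda>v. qf_holds v \<phi>) U"
    using ev_S by eventually_elim (simp add: S_def)
  then obtain f g where fg: "f \<in> mpolys_in L {0..Suc e}" "g \<in> mpolys_in L {0..Suc e}"
    "Factorial_Ring.irreducible f" "\<not> f dvd g"
    "eventually (\<lambda>s. \<exists>v\<in>assignments L (Suc e) (s 0). eval_mpoly v f = 0 \<and> eval_mpoly v g \<noteq> 0) U"
    "\<forall>v. (\<forall>i\<le>Suc e. v i \<in> L) \<longrightarrow> eval_mpoly v f = 0 \<longrightarrow> eval_mpoly v g \<noteq> 0 \<longrightarrow>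
       (\<exists>w\<in>assignments L e (v 0). qf_holds w \<phi>)"
    by (rule ex_hypersurface[OF not_const \<phi>])
  let ?H = "Hypersurface (Suc e) f g"
  define B where "B = {x \<in> L. disjunct_holds L ?H x}"
  have "B \<subseteq> A"
  proof
    fix x assume "x \<in> B"
    then obtain v where x: "x \<in> L" and v: "v \<in> assignments L (Suc e) x" "eval_mpoly v f = 0" "eval_mpoly v g \<noteq> 0"
      by (auto simp: B_def)
    have "v i \<in> L" if "i \<le> Suc e" for i
      using v(1) x that by (cases "i = 0") (auto simp: assignments_def)
    hence "\<exists>w\<in>assignments L e (v 0). qf_holds w \<phi>"
      using fg(6) v by blast
    moreover have "v 0 = x"
      using v(1) by (simp add: assignments_def)
    ultimately show "x \<in> A" using x by (simp add: A)
  qed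
  \<comment> \<open>The generic point lies on the hypersurface off the zeros of \<open>g\<close>, so
    \<open>U\<close> concentrates on \<open>B\<close>; membership of \<open>B\<close> in
    \<open>\<G>\<close> is then contradictory.\<close>
  have ev_B: "eventually (\<lambda>v. v 0 \<in> B) U"
    using fg(5) ev_S
  proof eventually_elim
    case (elim v)
    thus ?case using S_A[of v] assms(2) by (auto simp: B_def)
  qed
  \<comment> \<open>A finite \<open>B\<close> would force \<open>x\<close> to be constant along
    \<open>U\<close>.\<close>
  have "infinite B"
  proof
    assume "finite B"
    moreover have "eventually (\<lambda>v. \<exists>c\<in>B. v 0 = c) U"
      using ev_B by simp
    ultimately show False
      using ultrafilter_finite_ex[OF U(1), of B "\<lambda>c v. v 0 = c"] not_const by blast
  qed
  moreover have "h \<in> mpolys_over L (Suc e) \<and> h \<in> mpolys_over UNIV (Suc e)"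
    if "h \<in> mpolys_in L {0..Suc e}" for h
    using that mpolys_in_imp_over[of h] mpolys_in_mono[of L UNIV "{0..Suc e}"] by blast
  ultimately have "admissible L ?H"
    using fg(1-4) by (simp add: abs_irreducible_hypersurface_def B_def)
  moreover have "defined_set L [?H] = B"
    by (simp add: defined_set_def B_def)
  ultimately have "B \<in> \<G>"
    unfolding \<G>_def using \<open>B \<subseteq> A\<close> by (intro CollectI exI[of _ "[?H]"]) simp
  thus False using contra ev_B by blast
qed

end
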